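(* Let $\Gamma$ be a path for the weighted Markov-Dubins problem of type $CCC$, that is, of type $LRL$ or $RLR$ with all three segments of non-zero length. Then $\Gamma$ is not an optimal path admitting Pontryagin multipliers $(e,p,q,\beta)$ with $e=0$. In other words, for $e=0$ a non-trivial $CCC$ path is non-optimal.
   Context: Weighted Markov-Dubins problem: fix $U_L,U_R>0$, $r_L=1/U_L$, $r_R=1/U_R$, and penalties $\mu_L,\mu_R\ge0$ with $\mu_L+\mu_R>0$. Given configurations $(x_i,y_i,\alpha_i)$, $(x_f,y_f,\alpha_f)$ (headings are angles, identified modulo $2\pi$), minimize, over free final time $t_f$ and measurable controls $(u_L,u_R):[0,t_f]\to[0,U_L]\times[0,U_R]$, the cost $\int_0^{t_f}(1+\mu_Lu_L(t)+\mu_Ru_R(t))\,dt$ subject to $\dot x=\cos\alpha$, $\dot y=\sin\alpha$, $\dot\alpha=u_L-u_R$, $(x,y,\alpha)(0)=(x_i,y_i,\alpha_i)$, $(x,y,\alpha)(t_f)=(x_f,y_f,\alpha_f)$. An optimal path is a minimizer (taken with $t_f>0$). Multipliers: by Pontryagin's minimum principle an optimal path admits multipliers $(e,p,q,\beta)$: constants $e\ge0$, $p,q\in\mathbb R$ and an absolutely continuous $\beta:[0,t_f]\to\mathbb R$, not all identically zero, such that, with $\lambda=\sqrt{p^2+q^2}$ and $\phi$ an angle with $p=\lambda\cos\phi$, $q=\lambda\sin\phi$, one has $\dot\beta(t)=\lambda\sin(\alpha(t)-\phi)$, and for a.e. $t$ the control $(u_L(t),u_R(t))$ minimizes over $[0,U_L]\times[0,U_R]$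 the Hamiltonian $H=e+(\beta(t)+\mu_Le)u_L+(\mu_Re-\beta(t))u_R+\lambda\cos(\alpha(t)-\phi)$, with minimum value $H\equiv0$. Segments: an $L$ segment is a piece of path on a time interval where $(u_L,u_R)=(U_L,0)$ a.e.; an $R$ segment is one where $(u_L,u_R)=(0,U_R)$ a.e. A path is of type $X_1X_2X_3$ if it is the concatenation, in this order, of segments of these kinds. *)

theory Defs
  imports "HOL-Analysis.Analysis" "HOL-Library.Real_Mod"
begin

text \<open>Absolute continuity of a real function on an interval, in the usual epsilon-delta form.
  A finite family of non-overlapping compact intervals is a division of its own union.\<close>

definition abs_continuous_on :: "real set \<Rightarrow> (real \<Rightarrow> real) \<Rightarrow> bool" where
  "abs_continuous_on S f \<longleftrightarrow>
     (\<forall>\<epsilon>>0. \<exists>\<delta>>0. \<forall>\<D>. \<D> division_of \<Union>\<D> \<and> \<Union>\<D> \<subseteq> S \<and> (\<Sum>K\<in>\<D>. Sup K - Inf K) < \<delta>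
        \<longrightarrow> (\<Sum>K\<in>\<D>. \<bar>f (Sup K) - f (Inf K)\<bar>) < \<epsilon>)"

definition ac_solution_on :: "real \<Rightarrow> real \<Rightarrow> (real \<Rightarrow> real) \<Rightarrow> (real \<Rightarrow> real) \<Rightarrow> bool" where
  "ac_solution_on a b f g \<longleftrightarrow>
     abs_continuous_on {a..b} f \<and>
     (AE t in lebesgue_on {a..b}. (f has_real_derivative g t) (at t within {a..b}))"

text \<open>A configuration is a triple of position and heading angle.
  Only the values of the path functions on \<open>{0..final_time \<Gamma>}\<close> are ever constrained or used.\<close>

type_synonym config = "real \<times> real \<times> real"

record dubins_path =
  final_time :: real
  pos_x :: "real \<Rightarrow> real"
  pos_y :: "real \<Rightarrow> real"
  heading :: "real \<Rightarrow> real"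
  ctrl_L :: "real \<Rightarrow> real"
  ctrl_R :: "real \<Rightarrow> real"

definition at_config :: "dubins_path \<Rightarrow> real \<Rightarrow> config \<Rightarrow> bool" where
  "at_config \<Gamma> t c \<longleftrightarrow>
     (case c of (x, y, \<alpha>) \<Rightarrow>
        pos_x \<Gamma> t = x \<and> pos_y \<Gamma> t = y \<and> [heading \<Gamma> t = \<alpha>] (rmod (2 * pi)))"

definition admissible_path :: "real \<Rightarrow> real \<Rightarrow> config \<Rightarrow> config \<Rightarrow> dubins_path \<Rightarrow> bool" where
  "admissible_path U\<^sub>L U\<^sub>R c\<^sub>i c\<^sub>f \<Gamma> \<longleftrightarrow>
     (let T = final_time \<Gamma> in
        0 \<le> T \<and>
        ctrl_L \<Gamma> \<in> borel_measurable (lebesgue_on {0..T}) \<and>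
        ctrl_R \<Gamma> \<in> borel_measurable (lebesgue_on {0..T}) \<and>
        (\<forall>t\<in>{0..T}. ctrl_L \<Gamma> t \<in> {0..U\<^sub>L} \<and> ctrl_R \<Gamma> t \<in> {0..U\<^sub>R}) \<and>
        ac_solution_on 0 T (pos_x \<Gamma>) (\<lambda>t. cos (heading \<Gamma> t)) \<and>
        ac_solution_on 0 T (pos_y \<Gamma>) (\<lambda>t. sin (heading \<Gamma> t)) \<and>
        ac_solution_on 0 T (heading \<Gamma>) (\<lambda>t. ctrl_L \<Gamma> t - ctrl_R \<Gamma> t) \<and>
        at_config \<Gamma> 0 c\<^sub>i \<and> at_config \<Gamma> T c\<^sub>f)"

definition path_cost :: "real \<Rightarrow> real \<Rightarrow> dubins_path \<Rightarrow> real" where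
  "path_cost \<mu>\<^sub>L \<mu>\<^sub>R \<Gamma> =
     (LINT t|lebesgue_on {0..final_time \<Gamma>}. 1 + \<mu>\<^sub>L * ctrl_L \<Gamma> t + \<mu>\<^sub>R * ctrl_R \<Gamma> t)"

definition optimal_path ::
  "real \<Rightarrow> real \<Rightarrow> real \<Rightarrow> real \<Rightarrow> config \<Rightarrow> config \<Rightarrow> dubins_path \<Rightarrow> bool" where
  "optimal_path U\<^sub>L U\<^sub>R \<mu>\<^sub>L \<mu>\<^sub>R c\<^sub>i c\<^sub>f \<Gamma> \<longleftrightarrow>
     0 < final_time \<Gamma> \<and>
     is_arg_min (path_cost \<mu>\<^sub>L \<mu>\<^sub>R) (admissible_path U\<^sub>L U\<^sub>R c\<^sub>i c\<^sub>f) \<Gamma>"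

definition hamiltonian ::
  "real \<Rightarrow> real \<Rightarrow> real \<Rightarrow> real \<Rightarrow> real \<Rightarrow> real \<Rightarrow> real \<Rightarrow> real \<times> real \<Rightarrow> real" where
  "hamiltonian \<mu>\<^sub>L \<mu>\<^sub>R e \<Lambda> \<phi> b \<alpha> =
     (\<lambda>(v\<^sub>L, v\<^sub>R). e + (b + \<mu>\<^sub>L * e) * v\<^sub>L + (\<mu>\<^sub>R * e - b) * v\<^sub>R + \<Lambda> * cos (\<alpha> - \<phi>))"

text \<open>If \<open>p = q = 0\<close>, every angle \<open>\<phi>\<close> is allowed, but then \<open>\<Lambda> = 0\<close> and \<open>\<phi>\<close> plays no role.\<close>

definition pontryagin_multipliers ::
  "real \<Rightarrow> real \<Rightarrow> real \<Rightarrow> real \<Rightarrow> dubins_path \<Rightarrow> real \<Rightarrow> real \<Rightarrow> real \<Rightarrow> (real \<Rightarrow> real) \<Rightarrow> bool" where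
  "pontryagin_multipliers U\<^sub>L U\<^sub>R \<mu>\<^sub>L \<mu>\<^sub>R \<Gamma> e p q \<beta> \<longleftrightarrow>
     (let T = final_time \<Gamma>; \<Lambda> = sqrt (p\<^sup>2 + q\<^sup>2) in
        0 \<le> e \<and>
        \<not> (e = 0 \<and> p = 0 \<and> q = 0 \<and> (\<forall>t\<in>{0..T}. \<beta> t = 0)) \<and>
        (\<exists>\<phi>. p = \<Lambda> * cos \<phi> \<and> q = \<Lambda> * sin \<phi> \<and>
           ac_solution_on 0 T \<beta> (\<lambda>t. \<Lambda> * sin (heading \<Gamma> t - \<phi>)) \<and>
           (AE t in lebesgue_on {0..T}.
              let H = hamiltonian \<mu>\<^sub>L \<mu>\<^sub>R e \<Lambda> \<phi> (\<beta> t) (heading \<Gamma> t);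
                  u = (ctrl_L \<Gamma> t, ctrl_R \<Gamma> t)
              in is_arg_min H (\<lambda>v. v \<in> {0..U\<^sub>L} \<times> {0..U\<^sub>R}) u \<and> H u = 0)))"

datatype turn = Left_turn | Right_turn

fun turn_control :: "real \<Rightarrow> real \<Rightarrow> turn \<Rightarrow> real \<times> real" where
  "turn_control U\<^sub>L U\<^sub>R Left_turn = (U\<^sub>L, 0)"
| "turn_control U\<^sub>L U\<^sub>R Right_turn = (0, U\<^sub>R)"

definition is_segment ::
  "real \<Rightarrow> real \<Rightarrow> dubins_path \<Rightarrow> turn \<Rightarrow> real \<Rightarrow> real \<Rightarrow> bool" where
  "is_segment U\<^sub>L U\<^sub>R \<Gamma> X a b \<longleftrightarrow>
     (AE t in lebesgue_on {a..b}. (ctrl_L \<Gamma> t, ctrl_R \<Gamma> t) = turn_control U\<^sub>L U\<^sub>R X)"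

text \<open>Paths have unit speed, so the length of a segment is the length of its time interval;
  the strict inequalities below say that all three segments have non-zero length.\<close>

definition nontrivial_type ::
  "real \<Rightarrow> real \<Rightarrow> dubins_path \<Rightarrow> turn \<Rightarrow> turn \<Rightarrow> turn \<Rightarrow> bool" where
  "nontrivial_type U\<^sub>L U\<^sub>R \<Gamma> X\<^sub>1 X\<^sub>2 X\<^sub>3 \<longleftrightarrow>
     (\<exists>t\<^sub>1 t\<^sub>2. 0 < t\<^sub>1 \<and> t\<^sub>1 < t\<^sub>2 \<and> t\<^sub>2 < final_time \<Gamma> \<and>
        is_segment U\<^sub>L U\<^sub>R \<Gamma> X\<^sub>1 0 t\<^sub>1 \<and>
        is_segment U\<^sub>L U\<^sub>R \<Gamma> X\<^sub>2 t\<^sub>1 t\<^sub>2 \<and>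
        is_segment U\<^sub>L U\<^sub>R \<Gamma> X\<^sub>3 t\<^sub>2 (final_time \<Gamma>))"

definition nontrivial_CCC :: "real \<Rightarrow> real \<Rightarrow> dubins_path \<Rightarrow> bool" where
  "nontrivial_CCC U\<^sub>L U\<^sub>R \<Gamma> \<longleftrightarrow>
     nontrivial_type U\<^sub>L U\<^sub>R \<Gamma> Left_turn Right_turn Left_turn \<or>
     nontrivial_type U\<^sub>L U\<^sub>R \<Gamma> Right_turn Left_turn Right_turn"

end

theory Submission
  imports Defs
begin

text \<open>For \<open>e = 0\<close> the Hamiltonian on a segment of turn rate \<open>w\<close> (\<open>w = U\<^sub>L\<close> on \<open>L\<close>, \<open>w = -U\<^sub>R\<close> on \<open>R\<close>)
  reduces to \<open>w \<beta> + \<lambda> cos (\<alpha> - \<phi>) = 0\<close> with \<open>w \<beta> \<le> 0\<close>. So \<open>\<beta>\<close> vanishes at both switches, the heading is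
  orthogonal to \<open>\<phi>\<close> there, and \<open>cos (\<alpha> - \<phi>) \<ge> 0\<close> in between: the middle segment turns by exactly \<open>\<pi>\<close>.
  Such a path is not optimal. For small \<open>\<delta>\<close>, a half turn together with the adjacent opposite arcs
  of angle \<open>\<delta>\<close> can be replaced by two shorter turns and a straight segment, with savings of first
  order in \<open>\<delta>\<close> and a straight segment of length only of second order.\<close>

section \<open>Absolutely continuous solutions\<close>

lemma AE_lebesgue_on_iff_negligible:
  assumes "S \<in> sets lebesgue"
  shows "(AE t in lebesgue_on S. P t) \<longleftrightarrow> negligible {t \<in> S. \<not> P t}"
proof -
  have "(AE t in lebesgue_on S. P t) \<longleftrightarrow> (AE t in lebesgue. t \<in> S \<longrightarrow> P t)"
    by (rule AE_restrict_space_iff) (use assms in auto)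
  also have "\<dots> \<longleftrightarrow> negligible {t. \<not> (t \<in> S \<longrightarrow> P t)}"
    by (simp add: completion.AE_iff_null_sets negligible_iff_null_sets)
  also have "{t. \<not> (t \<in> S \<longrightarrow> P t)} = {t \<in> S. \<not> P t}"
    by auto
  finally show ?thesis .
qed

text \<open>Outer regularity gives an open \<open>W\<close> with \<open>W - N\<close> of small
  measure; since \<open>N\<close> is null, \<open>W\<close> has the same measure as
  \<open>W - N\<close>.\<close>

lemma negligible_open_superset:
  fixes N :: "'a::euclidean_space set"
  assumes "negligible N" "\<delta> > 0"
  obtains W where "open W" "N \<subseteq> W" "W \<in> lmeasurable" "measure lebesgue W < \<delta>"
proof -
  have "N \<in> sets lebesgue" by (simp add: assms(1) negligible_imp_sets)
  then obtain W where W: "open W" "N \<subseteq> W" "(W - N) \<in> lmeasurable" "emeasure lebesgue (W - N) < ennreal \<delta>"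
    using sets_lebesgue_outer_open assms(2) by blast
  have eq: "W = (W - N) \<union> N" using W(2) by auto
  have lm: "W \<in> lmeasurable"
    by (subst eq) (intro fmeasurable.Un W negligible_imp_measurable assms)
  have "emeasure lebesgue (W - N) = emeasure lebesgue W"
    using assms(1) by (intro emeasure_Diff_null_set) (auto simp: negligible_iff_null_sets lm fmeasurableD)
  then have "ennreal (measure lebesgue W) < ennreal \<delta>"
    using W(4) emeasure_eq_measure2[OF lm] by simp
  then have "measure lebesgue W < \<delta>" using assms(2) by (simp add: ennreal_less_iff)
  then show thesis using that W lm by blast
qed

lemma abs_continuous_on_subset:
  "abs_continuous_on S f \<Longrightarrow> T \<subseteq> S \<Longrightarrow> abs_continuous_on T f"
  unfolding abs_continuous_on_def by (meson subset_trans)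

text \<open>The points of the exceptional set are covered by an open set so small that, by absolute
  continuity, the increments of \<open>f\<close> over the intervals of a fine division tagged there have an arbitrarily small sum;
  at all other tags the usual differentiability estimate applies.\<close>

lemma abs_continuous_on_has_integral:
  fixes f :: "real \<Rightarrow> real"
  assumes "a \<le> b" and ac: "abs_continuous_on {a..b} f" and N: "negligible N"
    and der: "\<And>t. t \<in> {a..b} - N \<Longrightarrow> (f has_real_derivative g t) (at t within {a..b})"
  shows "(g has_integral (f b - f a)) {a..b}"
proof -
  \<comment> \<open>With the integrand reset to 0 on \<open>N\<close>, tags in \<open>N\<close>
    contribute nothing but increments of \<open>f\<close>. The change on a null set is undone at the
    end.\<close>
  define h where "h t = (if t \<in> N then 0 else g t)" for t
  have "(h has_integral (f b - f a)) {a..b}"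
    unfolding has_integral_real
  proof (intro allI impI)
    fix \<epsilon> :: real assume "\<epsilon> > 0"
    \<comment> \<open>Half of \<epsilon> is reserved for the tags outside \<open>N\<close>, whose
      errors add up to at most \<open>e * (b - a)\<close>; the \<open>+ 1\<close> keeps the
      denominator positive when \<open>a = b\<close>.\<close>
    define e where "e = \<epsilon> / (2 * (b - a + 1))"
    have "e > 0" using \<open>\<epsilon> > 0\<close> \<open>a \<le> b\<close> by (simp add: e_def)
    have eb: "e * (b - a) < \<epsilon> / 2" using \<open>\<epsilon> > 0\<close> \<open>a \<le> b\<close> by (simp add: e_def field_simps)
    obtain \<delta> where "\<delta> > 0" and \<delta>: "\<And>\<D>. \<D> division_of \<Union>\<D> \<Longrightarrow> \<Union>\<D> \<subseteq> {a..b} \<Longrightarrow>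
        (\<Sum>K\<in>\<D>. Sup K - Inf K) < \<delta> \<Longrightarrow> (\<Sum>K\<in>\<D>. \<bar>f (Sup K) - f (Inf K)\<bar>) < \<epsilon> / 2"
    proof -
      have "\<epsilon> / 2 > 0" using \<open>\<epsilon> > 0\<close> by simp
      with ac obtain \<delta> where "\<delta> > 0" "\<forall>\<D>. \<D> division_of \<Union>\<D> \<and> \<Union>\<D> \<subseteq> {a..b} \<and>
          (\<Sum>K\<in>\<D>. Sup K - Inf K) < \<delta> \<longrightarrow> (\<Sum>K\<in>\<D>. \<bar>f (Sup K) - f (Inf K)\<bar>) < \<epsilon> / 2"
        unfolding abs_continuous_on_def by blast
      then show ?thesis using that by simp
    qed
    obtain W where W: "open W" "N \<subseteq> W" "W \<in> lmeasurable" "measure lebesgue W < \<delta>"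
      using negligible_open_superset[OF N \<open>\<delta> > 0\<close>] by blast
    have "\<forall>x\<in>{a..b} - N. \<exists>d>0. \<forall>y\<in>{a..b}. norm (y - x) < d \<longrightarrow>
              norm (f y - f x - (y - x) * g x) \<le> e * norm (y - x)"
    proof
      fix x assume "x \<in> {a..b} - N"
      then have "(f has_vector_derivative g x) (at x within {a..b})"
        using der by (simp add: has_real_derivative_iff_has_vector_derivative)
      then show "\<exists>d>0. \<forall>y\<in>{a..b}. norm (y - x) < d \<longrightarrow>
              norm (f y - f x - (y - x) * g x) \<le> e * norm (y - x)"
        using \<open>e > 0\<close> unfolding has_vector_derivative_def has_derivative_within_alt by simp
    qed
    then obtain d where d: "\<And>x. x \<in> {a..b} - N \<Longrightarrow> d x > 0"
      "\<And>x y. x \<in> {a..b} - N \<Longrightarrow> y \<in> {a..b} \<Longrightarrow> norm (y - x) < d x \<Longrightarrow>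
          norm (f y - f x - (y - x) * g x) \<le> e * norm (y - x)"
      by metis
    \<comment> \<open>At tags in \<open>N\<close> the gauge keeps intervals inside \<open>W\<close>;
      at the other tags it keeps them where the derivative estimate holds. Tags lie in
      \<open>{a..b}\<close>, so the radius 1 elsewhere is a mere default.\<close>
    define \<gamma> where "\<gamma> x = (if x \<in> N then W else if x \<in> {a..b} then ball x (d x) else ball x 1)" for x
    have "gauge \<gamma>"
      unfolding gauge_def \<gamma>_def using W d(1) by auto
    moreover have "norm ((\<Sum>(x, K)\<in>p. measure lborel K *\<^sub>R h x) - (f b - f a)) < \<epsilon>"
      if p: "p tagged_division_of {a..b}" "\<gamma> fine p" for p
    proof -
      note pD = tagged_division_ofD[OF p(1)]
      have sums: "b - a = (\<Sum>(x,K)\<in>p. Sup K - Inf K)" "f b - f a = (\<Sum>(x,K)\<in>p. f (Sup K) - f (Inf K))"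
        using additive_tagged_division_1[where f="\<lambda>x. x"] additive_tagged_division_1[where f=f]
          \<open>a \<le> b\<close> p(1) by auto
      have ival: "\<exists>u v. u \<le> v \<and> K = {u..v} \<and> x \<in> {u..v} \<and> u \<in> {a..b} \<and> v \<in> {a..b} \<and> Inf K = u \<and> Sup K = v"
        if xK: "(x, K) \<in> p" for x K
      proof -
        obtain u v where K: "K = {u..v}" using pD(4)[OF xK] by auto
        have "x \<in> K" "K \<subseteq> {a..b}" using pD(2,3)[OF xK] by auto
        then have "u \<le> v" using K by auto
        then show ?thesis using K \<open>x \<in> K\<close> \<open>K \<subseteq> {a..b}\<close> by (intro exI[of _ u] exI[of _ v]) auto
      qed
      define q where "q = {z \<in> p. fst z \<in> N}"
      have "q \<subseteq> p" by (auto simp: q_def)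
      have "finite p" using pD by simp
      have qt: "q tagged_division_of \<Union>(snd ` q)"
        using tagged_partial_division_of_Union_self tagged_partial_division_subset
          p(1)[unfolded tagged_division_of_def] \<open>q \<subseteq> p\<close> by blast
      have div: "(snd ` q) division_of \<Union>(snd ` q)"
        by (rule division_of_tagged_division[OF qt])
      have sub: "\<Union>(snd ` q) \<subseteq> {a..b}"
        using pD(3) \<open>q \<subseteq> p\<close> by fastforce
      have subO: "\<Union>(snd ` q) \<subseteq> W"
        using p(2) unfolding fine_def q_def \<gamma>_def by fastforce
      have "(\<Sum>K\<in>snd ` q. Sup K - Inf K) = (\<Sum>K\<in>snd ` q. measure lebesgue K)"
      proof (rule sum.cong)
        fix K assume "K \<in> snd ` q"
        then obtain x where "(x, K) \<in> p" using \<open>q \<subseteq> p\<close> by auto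
        then obtain u v where "u \<le> v" "K = {u..v}" using ival by blast
        then show "Sup K - Inf K = measure lebesgue K" by simp
      qed simp
      also have "\<dots> = measure lebesgue (\<Union>(snd ` q))" by (rule content_division[OF div])
      also have "\<dots> \<le> measure lebesgue W"
        using subO W(3) lmeasurable_division[OF div] by (intro measure_mono_fmeasurable) (auto simp: fmeasurableD)
      finally have "(\<Sum>K\<in>snd ` q. Sup K - Inf K) < \<delta>" using W(4) by simp
      then have small: "(\<Sum>K\<in>snd ` q. \<bar>f (Sup K) - f (Inf K)\<bar>) < \<epsilon> / 2"
        using \<delta> div sub by blast
      \<comment> \<open>A sum over tagged pairs equals the sum over their intervals for functions
        that vanish on boxes with empty interior. \<open>D\<close> forces the value 0 on the empty
        set, where \<open>Sup\<close> and \<open>Inf\<close> mean nothing.\<close>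
      define D where "D K = (if K = {} then 0 else \<bar>f (Sup K) - f (Inf K)\<bar>)" for K :: "real set"
      have "D (cbox u v) = 0" if "box u v = {}" for u v :: real
        using that by (cases "u = v") (auto simp: D_def box_eq_empty)
      then have "(\<Sum>(x, K)\<in>q. D K) = (\<Sum>K\<in>snd ` q. D K)"
        by (rule sum.over_tagged_division_lemma[OF qt])
      moreover have "(\<Sum>(x, K)\<in>q. \<bar>f (Sup K) - f (Inf K)\<bar>) = (\<Sum>(x, K)\<in>q. D K)"
        using pD(2) \<open>q \<subseteq> p\<close> by (intro sum.cong) (force simp: D_def)+
      moreover have "(\<Sum>K\<in>snd ` q. D K) \<le> (\<Sum>K\<in>snd ` q. \<bar>f (Sup K) - f (Inf K)\<bar>)"
        by (intro sum_mono) (auto simp: D_def)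
      ultimately have bad: "(\<Sum>(x, K)\<in>q. \<bar>f (Sup K) - f (Inf K)\<bar>) < \<epsilon> / 2"
        using small by linarith
      have good: "norm (measure lborel K *\<^sub>R h x - (f (Sup K) - f (Inf K))) \<le> e * (Sup K - Inf K)"
        if xK: "(x, K) \<in> p - q" for x K
      proof -
        obtain u v where uv: "u \<le> v" "K = {u..v}" "x \<in> {u..v}" "u \<in> {a..b}" "v \<in> {a..b}" "Inf K = u" "Sup K = v"
          using ival xK by blast
        have xN: "x \<in> {a..b} - N" using xK uv by (auto simp: q_def)
        have "K \<subseteq> \<gamma> x" using p(2) xK unfolding fine_def by auto
        then have "K \<subseteq> ball x (d x)" using xN by (simp add: \<gamma>_def)
        then have "norm (u - x) < d x" "norm (v - x) < d x"
          using uv(1,2) by (auto simp: subset_iff dist_real_def)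
        then have fuv: "norm (f u - f x - (u - x) * g x) \<le> e * norm (u - x)"
           "norm (f v - f x - (v - x) * g x) \<le> e * norm (v - x)"
          using d(2)[OF xN uv(4)] d(2)[OF xN uv(5)] by blast+
        have e_uv: "e * norm (u - x) + e * norm (v - x) = e * (Sup K - Inf K)"
          using uv by (simp add: algebra_simps)
        \<comment> \<open>The interval is split at its tag: the errors at \<open>u\<close> and
          \<open>v\<close> are at most \<open>e * (x - u)\<close> and \<open>e * (v - x)\<close>,
          which add up to \<open>e\<close> times the length.\<close>
        have "measure lborel K *\<^sub>R h x - (f (Sup K) - f (Inf K)) =
            (f u - f x - (u - x) * g x) - (f v - f x - (v - x) * g x)"
          using uv xN by (simp add: h_def algebra_simps)
        then show ?thesis
          using norm_triangle_le_diff[OF add_mono[OF fuv, unfolded e_uv]] by simp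
      qed
      let ?F = "\<lambda>(x, K). measure lborel K *\<^sub>R h x - (f (Sup K) - f (Inf K))"
      have "(\<Sum>(x, K)\<in>p. measure lborel K *\<^sub>R h x) - (f b - f a) = sum ?F p"
        unfolding sums(2) by (simp add: split_def sum_subtractf)
      also have "\<dots> = sum ?F (p - q) + sum ?F q"
        using \<open>finite p\<close> \<open>q \<subseteq> p\<close> by (rule sum.subset_diff[rotated])
      finally have "norm ((\<Sum>(x, K)\<in>p. measure lborel K *\<^sub>R h x) - (f b - f a)) \<le> norm (sum ?F (p - q)) + norm (sum ?F q)"
        by (simp only: norm_triangle_ineq)
      moreover have "norm (sum ?F (p - q)) \<le> (\<Sum>(x, K)\<in>p - q. e * (Sup K - Inf K))"
        using good by (intro sum_norm_le) auto
      moreover have "(\<Sum>(x, K)\<in>p - q. e * (Sup K - Inf K)) \<le> (\<Sum>(x, K)\<in>p. e * (Sup K - Inf K))"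
      proof (rule sum_mono2)
        fix z assume "z \<in> p - (p - q)"
        then obtain x K where "z = (x, K)" "(x, K) \<in> p" by (cases z) auto
        then show "0 \<le> (case z of (x, K) \<Rightarrow> e * (Sup K - Inf K))"
          using ival[of x K] \<open>e > 0\<close> by auto
      qed (use \<open>finite p\<close> in auto)
      moreover have "(\<Sum>(x, K)\<in>p. e * (Sup K - Inf K)) = e * (b - a)"
        unfolding sums(1) by (simp add: split_def sum_distrib_left)
      moreover have "norm (sum ?F q) \<le> (\<Sum>(x, K)\<in>q. \<bar>f (Sup K) - f (Inf K)\<bar>)"
        by (intro sum_norm_le) (auto simp: h_def q_def)
      ultimately show ?thesis using bad eb by linarith
    qed
    ultimately show "\<exists>\<gamma>. gauge \<gamma> \<and> (\<forall>p. p tagged_division_of {a..b} \<and> \<gamma> fine p \<longrightarrow>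
        norm ((\<Sum>(x, K)\<in>p. measure lborel K *\<^sub>R h x) - (f b - f a)) < \<epsilon>)"
      by (intro exI[of _ \<gamma>]) auto
  qed
  then show ?thesis
    by (rule has_integral_spike[OF N, rotated]) (auto simp: h_def)
qed

section \<open>Restriction, continuity and Lipschitz bounds of solutions\<close>

lemma ac_solution_on_subset:
  assumes "ac_solution_on a b f g" "{c..d} \<subseteq> {a..b}"
  shows "ac_solution_on c d f g"
proof -
  have "negligible {t \<in> {a..b}. \<not> (f has_real_derivative g t) (at t within {a..b})}"
    using assms(1) by (simp add: ac_solution_on_def AE_lebesgue_on_iff_negligible)
  then have "negligible {t \<in> {c..d}. \<not> (f has_real_derivative g t) (at t within {c..d})}"
    by (rule negligible_subset) (use assms(2) DERIV_subset[OF _ assms(2)] in blast)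
  then show ?thesis
    using assms abs_continuous_on_subset by (auto simp: ac_solution_on_def AE_lebesgue_on_iff_negligible)
qed

lemma ac_solution_on_has_integral:
  assumes "ac_solution_on a b f g" "a \<le> b"
  shows "(g has_integral (f b - f a)) {a..b}"
proof (rule abs_continuous_on_has_integral[OF assms(2)])
  let ?N = "{t \<in> {a..b}. \<not> (f has_real_derivative g t) (at t within {a..b})}"
  show "negligible ?N"
    using assms(1) by (simp add: ac_solution_on_def AE_lebesgue_on_iff_negligible)
qed (use assms in \<open>auto simp: ac_solution_on_def\<close>)

text \<open>\<open>f\<close> is a constant plus the indefinite integral of \<open>g\<close>, and
  indefinite integrals are continuous.\<close>

lemma ac_solution_on_continuous:
  assumes "ac_solution_on a b f g"
  shows "continuous_on {a..b} f"
proof (cases "a \<le> b")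
  case True
  have "g integrable_on {a..b}"
    using ac_solution_on_has_integral[OF assms True] by blast
  then have "continuous_on {a..b} (\<lambda>t. f a + integral {a..t} g)"
    by (intro continuous_intros indefinite_integral_continuous_1)
  moreover have "f a + integral {a..t} g = f t" if "t \<in> {a..b}" for t
    using ac_solution_on_has_integral[OF ac_solution_on_subset[OF assms, of a t]] that
    by (auto simp: integral_unique)
  ultimately show ?thesis by (metis (no_types, lifting) continuous_on_cong)
qed simp

lemma ac_solution_on_lipschitz:
  assumes "ac_solution_on a b f g" "\<And>t. t \<in> {a..b} \<Longrightarrow> \<bar>g t\<bar> \<le> B" "B \<ge> 0"
  shows "B-lipschitz_on {a..b} f"
proof (rule lipschitz_on_leI)
  fix u v assume uv: "u \<in> {a..b}" "v \<in> {a..b}" "u \<le> v"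
  have "(g has_integral (f v - f u)) {u..v}"
    using uv by (intro ac_solution_on_has_integral ac_solution_on_subset[OF assms(1)]) auto
  from has_integral_bound_real[OF \<open>B \<ge> 0\<close> finite.emptyI this] have "norm (f v - f u) \<le> B * (v - u)"
    using uv assms(2) by auto
  then show "dist (f u) (f v) \<le> B * dist u v"
    using uv by (simp add: dist_real_def abs_minus_commute)
qed fact

lemma lipschitz_on_imp_abs_continuous_on:
  fixes f :: "real \<Rightarrow> real"
  assumes "B-lipschitz_on S f"
  shows "abs_continuous_on S f"
  unfolding abs_continuous_on_def
proof (intro allI impI)
  fix \<epsilon> :: real assume "\<epsilon> > 0"
  have "B \<ge> 0" using assms by (rule lipschitz_on_nonneg)
  show "\<exists>\<delta>>0. \<forall>\<D>. \<D> division_of \<Union>\<D> \<and> \<Union>\<D> \<subseteq> S \<and> (\<Sum>K\<in>\<D>. Sup K - Inf K) < \<delta>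
        \<longrightarrow> (\<Sum>K\<in>\<D>. \<bar>f (Sup K) - f (Inf K)\<bar>) < \<epsilon>"
  \<comment> \<open>The choice \<open>B + 1\<close> instead of \<open>B\<close> keeps the quotient
    positive for \<open>B = 0\<close> as well.\<close>
  proof (intro exI[of _ "\<epsilon> / (B + 1)"] conjI allI impI; (elim conjE)?)
    fix \<D> :: "real set set"
    assume D: "\<D> division_of \<Union>\<D>" "\<Union>\<D> \<subseteq> S" "(\<Sum>K\<in>\<D>. Sup K - Inf K) < \<epsilon> / (B + 1)"
    have K: "\<bar>f (Sup K) - f (Inf K)\<bar> \<le> B * (Sup K - Inf K) \<and> 0 \<le> Sup K - Inf K" if KD: "K \<in> \<D>" for K
    proof -
      obtain u v where K: "K = {u..v}" "u \<le> v"
        using division_ofD(3)[OF D(1) KD] division_ofD(4)[OF D(1) KD] by (metis atLeastatMost_empty_iff2 box_real(2))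
      then have "u \<in> \<Union>\<D>" "v \<in> \<Union>\<D>" using KD by auto
      then have "u \<in> S" "v \<in> S" using D(2) by auto
      then show ?thesis
        using lipschitz_onD[OF assms, of v u] K by (simp add: dist_real_def)
    qed
    have "(\<Sum>K\<in>\<D>. \<bar>f (Sup K) - f (Inf K)\<bar>) \<le> B * (\<Sum>K\<in>\<D>. Sup K - Inf K)"
      unfolding sum_distrib_left using K by (intro sum_mono) auto
    also have "\<dots> \<le> (B + 1) * (\<Sum>K\<in>\<D>. Sup K - Inf K)"
      using K by (intro mult_right_mono sum_nonneg) auto
    also have "\<dots> < \<epsilon>"
      using D(3) \<open>B \<ge> 0\<close> by (simp add: field_simps)
    finally show "(\<Sum>K\<in>\<D>. \<bar>f (Sup K) - f (Inf K)\<bar>) < \<epsilon>" .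
  qed (use \<open>\<epsilon> > 0\<close> \<open>B \<ge> 0\<close> in auto)
qed

text \<open>The complement of a null set is dense in a nondegenerate interval, and continuity
  carries a closed condition from a dense subset to its closure, end points included.\<close>

lemma AE_imp_closed_everywhere:
  fixes h :: "real \<Rightarrow> 'a::topological_space"
  assumes "a < b" "continuous_on {a..b} h" "closed C" "AE t in lebesgue_on {a..b}. h t \<in> C"
    and "t \<in> {a..b}"
  shows "h t \<in> C"
proof -
  define N where "N = {t \<in> {a..b}. h t \<notin> C}"
  have "negligible N" using assms(4) by (simp add: N_def AE_lebesgue_on_iff_negligible)
  then have "interior N = {}"
    by (metis interior_subset negligible_subset open_interior open_not_negligible)
  then have "closure (- N) = UNIV" by (simp add: closure_complement)
  then have "{a<..<b} \<subseteq> closure ({a<..<b} \<inter> - N)"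
    using open_Int_closure_subset[of "{a<..<b}" "- N"] by simp
  then have "{a..b} \<subseteq> closure ({a<..<b} \<inter> - N)"
    by (metis \<open>a < b\<close> closure_closure closure_greaterThanLessThan closure_mono)
  moreover have "closure ({a<..<b} \<inter> - N) \<subseteq> {a..b}"
    by (metis \<open>a < b\<close> closure_greaterThanLessThan closure_mono inf_le1)
  ultimately have cl: "closure ({a<..<b} \<inter> - N) = {a..b}" by simp
  have "h ` closure ({a<..<b} \<inter> - N) \<subseteq> C"
    using assms(2,3) cl by (intro image_closure_subset) (auto simp: N_def)
  then show ?thesis using assms(5) cl by auto
qed

section \<open>Paths with piecewise constant controls\<close>

text \<open>The first piece is \<open>B\<close>-Lipschitz by integration, the second by the mean
  value theorem, and they agree at \<open>b\<close>; so the joined function is Lipschitz, hence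
  absolutely continuous. The only new exceptional point is the joint \<open>b\<close>.\<close>

lemma ac_solution_on_append:
  assumes ac: "ac_solution_on a b f g" and ab: "a \<le> b" "b \<le> c"
    and gB: "\<And>t. t \<in> {a..b} \<Longrightarrow> \<bar>g t\<bar> \<le> B"
    and F: "\<And>t. t \<in> {b..c} \<Longrightarrow> (F has_real_derivative G t) (at t)"
    and GB: "\<And>t. t \<in> {b..c} \<Longrightarrow> \<bar>G t\<bar> \<le> B"
    and eq: "F b = f b"
    and h: "\<And>t. t \<in> {a..b} \<Longrightarrow> h t = g t" "\<And>t. t \<in> {b<..c} \<Longrightarrow> h t = G t"
  shows "ac_solution_on a c (\<lambda>t. if t \<le> b then f t else F t) h"
  unfolding ac_solution_on_def
proof
  have "B \<ge> 0" using GB[of b] ab by auto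
  have "B-lipschitz_on {b..c} F"
  proof (rule lipschitz_onI)
    fix u v assume "u \<in> {b..c}" "v \<in> {b..c}"
    then have "norm (F u - F v) \<le> B * norm (u - v)"
      by (intro field_differentiable_bound[of "{b..c}" F G])
        (use F GB in \<open>auto intro: has_field_derivative_at_within\<close>)
    then show "dist (F u) (F v) \<le> B * dist u v" by (simp add: dist_norm)
  qed fact
  then have "B-lipschitz_on {a..c} (\<lambda>t. if t \<le> b then f t else F t)"
    using ac_solution_on_lipschitz[OF ac gB \<open>B \<ge> 0\<close>] eq by (intro lipschitz_on_concat) auto
  then show "abs_continuous_on {a..c} (\<lambda>t. if t \<le> b then f t else F t)"
    by (rule lipschitz_on_imp_abs_continuous_on)
  let ?N = "{t \<in> {a..b}. \<not> (f has_real_derivative g t) (at t within {a..b})}"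
  have "negligible (insert b ?N)"
    using ac by (simp add: ac_solution_on_def AE_lebesgue_on_iff_negligible)
  moreover have "((\<lambda>t. if t \<le> b then f t else F t) has_real_derivative h t) (at t within {a..c})"
    if t: "t \<in> {a..c}" "t \<notin> insert b ?N" for t
  proof (cases "t < b")
    case True
    then have tab: "t \<in> {a..b}" using t by auto
    have "at t within {a..c} = at t within {a..b}"
      by (rule at_within_nhd[of t "{..<b}"]) (use True ab in auto)
    moreover have "(f has_real_derivative g t) (at t within {a..b})"
      using t tab by auto
    then have "((\<lambda>t. if t \<le> b then f t else F t) has_real_derivative g t) (at t within {a..b})"
      by (rule has_field_derivative_transform_within[of _ _ _ _ 1]) (use tab in auto)
    ultimately show ?thesis using h(1)[OF tab] by simp
  next
    case False
    then have tbc: "t \<in> {b<..c}" using t by auto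
    then have "(F has_real_derivative G t) (at t)" using F by auto
    then have "((\<lambda>t. if t \<le> b then f t else F t) has_real_derivative G t) (at t)"
      by (rule has_field_derivative_transform_within_open[of _ _ _ "{b<..}"]) (use tbc in auto)
    then show ?thesis using h(2)[OF tbc] by (simp add: has_field_derivative_at_within)
  qed
  then have "{t \<in> {a..c}.
      \<not> ((\<lambda>t. if t \<le> b then f t else F t) has_real_derivative h t) (at t within {a..c})} \<subseteq> insert b ?N"
    by blast
  ultimately have "negligible {t \<in> {a..c}.
      \<not> ((\<lambda>t. if t \<le> b then f t else F t) has_real_derivative h t) (at t within {a..c})}"
    by (rule negligible_subset)
  then show "AE t in lebesgue_on {a..c}.
      ((\<lambda>t. if t \<le> b then f t else F t) has_real_derivative h t) (at t within {a..c})"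
    by (simp add: AE_lebesgue_on_iff_negligible)
qed

text \<open>Displacement after time \<open>s\<close> from heading \<open>\<alpha>\<close> at unit speed and constant turn rate \<open>w\<close>.\<close>

definition arc_x :: "real \<Rightarrow> real \<Rightarrow> real \<Rightarrow> real" where
  "arc_x w \<alpha> s = (if w = 0 then s * cos \<alpha> else (sin (\<alpha> + w * s) - sin \<alpha>) / w)"

definition arc_y :: "real \<Rightarrow> real \<Rightarrow> real \<Rightarrow> real" where
  "arc_y w \<alpha> s = (if w = 0 then s * sin \<alpha> else (cos \<alpha> - cos (\<alpha> + w * s)) / w)"

lemma arc_0 [simp]: "arc_x w \<alpha> 0 = 0" "arc_y w \<alpha> 0 = 0"
  by (simp_all add: arc_x_def arc_y_def)

text \<open>The general offset, starting time and domain let the same fact serve both for appending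
  an arc to a path and for integrating along a segment.\<close>

lemma arc_x_deriv: "((\<lambda>t. x + arc_x w \<alpha> (t - a)) has_real_derivative cos (\<alpha> + w * (t - a))) (at t within S)"
  unfolding arc_x_def by (cases "w = 0") (auto intro!: derivative_eq_intros)

lemma arc_y_deriv: "((\<lambda>t. y + arc_y w \<alpha> (t - a)) has_real_derivative sin (\<alpha> + w * (t - a))) (at t within S)"
  unfolding arc_y_def by (cases "w = 0") (auto intro!: derivative_eq_intros)

section \<open>Building paths from pieces with constant controls\<close>

text \<open>Both pieces, extended by zero to the whole line, are measurable; their sum restricts to
  the joined function.\<close>

lemma borel_measurable_append:
  fixes f :: "real \<Rightarrow> real"
  assumes "f \<in> borel_measurable (lebesgue_on {a..b})" "b \<le> c"
  shows "(\<lambda>t. if t \<le> b then f t else v) \<in> borel_measurable (lebesgue_on {a..c})"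
proof (cases "a \<le> b")
  case True
  have "(\<lambda>t. if t \<in> {a..b} then f t else 0) \<in> borel_measurable lebesgue"
    using assms(1) by (rule borel_measurable_if_I) simp
  then have "(\<lambda>t. (if t \<in> {a..b} then f t else 0) + (if t \<in> {b<..c} then v else 0)) \<in> borel_measurable lebesgue"
    by (rule borel_measurable_add) (rule borel_measurable_if_I, auto)
  also have "(\<lambda>t. (if t \<in> {a..b} then f t else 0) + (if t \<in> {b<..c} then v else 0)) =
      (\<lambda>t. if t \<in> {a..c} then (if t \<le> b then f t else v) else 0)"
    using assms(2) True by (auto simp: fun_eq_iff)
  finally show ?thesis by (rule borel_measurable_if_D)
next
  case False
  then show ?thesis by (subst measurable_cong[of _ _ "\<lambda>t. v"]) auto
qed

text \<open>The final heading is fixed exactly and not only modulo \<open_angle>\<close>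

definition reaches ::
  "real \<Rightarrow> real \<Rightarrow> real \<Rightarrow> real \<Rightarrow> config \<Rightarrow> real \<Rightarrow> real \<Rightarrow> real \<Rightarrow> real \<Rightarrow> bool" where
  "reaches U\<^sub>L U\<^sub>R \<mu>\<^sub>L \<mu>\<^sub>R c x y \<alpha> J \<longleftrightarrow>
     (\<exists>\<Gamma>. admissible_path U\<^sub>L U\<^sub>R c (x, y, \<alpha>) \<Gamma> \<and> heading \<Gamma> (final_time \<Gamma>) = \<alpha> \<and>
        ((\<lambda>t. 1 + \<mu>\<^sub>L * ctrl_L \<Gamma> t + \<mu>\<^sub>R * ctrl_R \<Gamma> t) has_integral J) {0..final_time \<Gamma>})"

lemma reaches_start:
  assumes "0 \<le> U\<^sub>L" "0 \<le> U\<^sub>R" "[\<alpha> = \<alpha>\<^sub>0] (rmod (2 * pi))"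
  shows "reaches U\<^sub>L U\<^sub>R \<mu>\<^sub>L \<mu>\<^sub>R (x, y, \<alpha>\<^sub>0) x y \<alpha> 0"
proof -
  let ?\<Gamma> = "\<lparr>final_time = 0, pos_x = \<lambda>_. x, pos_y = \<lambda>_. y, heading = \<lambda>_. \<alpha>,
              ctrl_L = \<lambda>_. 0, ctrl_R = \<lambda>_. 0\<rparr>"
  have "abs_continuous_on {0..0} (\<lambda>_. z)" for z
    by (rule lipschitz_on_imp_abs_continuous_on[of 0]) (rule lipschitz_onI, auto)
  moreover have "negligible {t \<in> {0..0}. P t}" for P :: "real \<Rightarrow> bool"
    by (rule negligible_subset[of "{0}"]) auto
  ultimately have "ac_solution_on 0 0 (\<lambda>_. z) g" for z g
    by (simp add: ac_solution_on_def AE_lebesgue_on_iff_negligible del: atLeastAtMost_singleton)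
  then have "admissible_path U\<^sub>L U\<^sub>R (x, y, \<alpha>\<^sub>0) (x, y, \<alpha>) ?\<Gamma>"
    using assms by (simp add: admissible_path_def at_config_def)
  then show ?thesis
    unfolding reaches_def by (intro exI[of _ ?\<Gamma>]) auto
qed

lemma reaches_extend:
  assumes "reaches U\<^sub>L U\<^sub>R \<mu>\<^sub>L \<mu>\<^sub>R c x y \<alpha> J"
    and "0 \<le> \<tau>" and v: "v\<^sub>L \<in> {0..U\<^sub>L}" "v\<^sub>R \<in> {0..U\<^sub>R}" and w: "w = v\<^sub>L - v\<^sub>R"
  shows "reaches U\<^sub>L U\<^sub>R \<mu>\<^sub>L \<mu>\<^sub>R c (x + arc_x w \<alpha> \<tau>) (y + arc_y w \<alpha> \<tau>) (\<alpha> + w * \<tau>)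
           (J + \<tau> * (1 + \<mu>\<^sub>L * v\<^sub>L + \<mu>\<^sub>R * v\<^sub>R))"
proof -
  obtain \<Gamma> where adm: "admissible_path U\<^sub>L U\<^sub>R c (x, y, \<alpha>) \<Gamma>"
    and hT: "heading \<Gamma> (final_time \<Gamma>) = \<alpha>"
    and J: "((\<lambda>t. 1 + \<mu>\<^sub>L * ctrl_L \<Gamma> t + \<mu>\<^sub>R * ctrl_R \<Gamma> t) has_integral J) {0..final_time \<Gamma>}"
    using assms(1) unfolding reaches_def by blast
  define T where "T = final_time \<Gamma>"
  have a: "0 \<le> T"
    "ctrl_L \<Gamma> \<in> borel_measurable (lebesgue_on {0..T})"
    "ctrl_R \<Gamma> \<in> borel_measurable (lebesgue_on {0..T})"
    "\<And>t. t \<in> {0..T} \<Longrightarrow> ctrl_L \<Gamma> t \<in> {0..U\<^sub>L} \<and> ctrl_R \<Gamma> t \<in> {0..U\<^sub>R}"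
    "ac_solution_on 0 T (pos_x \<Gamma>) (\<lambda>t. cos (heading \<Gamma> t))"
    "ac_solution_on 0 T (pos_y \<Gamma>) (\<lambda>t. sin (heading \<Gamma> t))"
    "ac_solution_on 0 T (heading \<Gamma>) (\<lambda>t. ctrl_L \<Gamma> t - ctrl_R \<Gamma> t)"
    "at_config \<Gamma> 0 c" "at_config \<Gamma> T (x, y, \<alpha>)"
    using adm unfolding admissible_path_def T_def by (auto simp: Let_def)
  have ends: "pos_x \<Gamma> T = x" "pos_y \<Gamma> T = y" "heading \<Gamma> T = \<alpha>"
    using a(9) hT by (auto simp: at_config_def T_def)
  define \<Gamma>' where "\<Gamma>' = \<lparr>final_time = T + \<tau>,
     pos_x = \<lambda>t. if t \<le> T then pos_x \<Gamma> t else x + arc_x w \<alpha> (t - T),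
     pos_y = \<lambda>t. if t \<le> T then pos_y \<Gamma> t else y + arc_y w \<alpha> (t - T),
     heading = \<lambda>t. if t \<le> T then heading \<Gamma> t else \<alpha> + w * (t - T),
     ctrl_L = \<lambda>t. if t \<le> T then ctrl_L \<Gamma> t else v\<^sub>L,
     ctrl_R = \<lambda>t. if t \<le> T then ctrl_R \<Gamma> t else v\<^sub>R\<rparr>"
  have final: "pos_x \<Gamma>' (T + \<tau>) = x + arc_x w \<alpha> \<tau>" "pos_y \<Gamma>' (T + \<tau>) = y + arc_y w \<alpha> \<tau>"
    "heading \<Gamma>' (T + \<tau>) = \<alpha> + w * \<tau>"
    using \<open>0 \<le> \<tau>\<close> by (auto simp: \<Gamma>'_def ends)
  have "ac_solution_on 0 (T + \<tau>) (pos_x \<Gamma>') (\<lambda>t. cos (heading \<Gamma>' t))"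
    unfolding \<Gamma>'_def dubins_path.simps
    by (rule ac_solution_on_append[OF a(5,1), where B=1 and G="\<lambda>t. cos (\<alpha> + w * (t - T))"])
      (use \<open>0 \<le> \<tau>\<close> ends in \<open>auto intro: arc_x_deriv\<close>)
  moreover have "ac_solution_on 0 (T + \<tau>) (pos_y \<Gamma>') (\<lambda>t. sin (heading \<Gamma>' t))"
    unfolding \<Gamma>'_def dubins_path.simps
    by (rule ac_solution_on_append[OF a(6,1), where B=1 and G="\<lambda>t. sin (\<alpha> + w * (t - T))"])
      (use \<open>0 \<le> \<tau>\<close> ends in \<open>auto intro: arc_y_deriv\<close>)
  moreover have "ac_solution_on 0 (T + \<tau>) (heading \<Gamma>') (\<lambda>t. ctrl_L \<Gamma>' t - ctrl_R \<Gamma>' t)"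
    unfolding \<Gamma>'_def dubins_path.simps
  proof (rule ac_solution_on_append[OF a(7,1), where B="U\<^sub>L + U\<^sub>R" and G="\<lambda>t. w"])
    fix t assume "t \<in> {0..T}"
    from a(4)[OF this] show "\<bar>ctrl_L \<Gamma> t - ctrl_R \<Gamma> t\<bar> \<le> U\<^sub>L + U\<^sub>R" by auto
  qed (use \<open>0 \<le> \<tau>\<close> ends v w in \<open>auto intro!: derivative_eq_intros\<close>)
  moreover have "ctrl_L \<Gamma>' \<in> borel_measurable (lebesgue_on {0..T + \<tau>})"
    "ctrl_R \<Gamma>' \<in> borel_measurable (lebesgue_on {0..T + \<tau>})"
    unfolding \<Gamma>'_def dubins_path.simps using \<open>0 \<le> \<tau>\<close>
    by (auto intro!: borel_measurable_append a)
  moreover have "\<forall>t\<in>{0..T + \<tau>}. ctrl_L \<Gamma>' t \<in> {0..U\<^sub>L} \<and> ctrl_R \<Gamma>' t \<in> {0..U\<^sub>R}"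
    using a(4) v by (simp add: \<Gamma>'_def)
  moreover have "at_config \<Gamma>' 0 c"
    using a(8,1) by (simp add: at_config_def \<Gamma>'_def)
  ultimately have "admissible_path U\<^sub>L U\<^sub>R c (x + arc_x w \<alpha> \<tau>, y + arc_y w \<alpha> \<tau>, \<alpha> + w * \<tau>) \<Gamma>'"
    using final \<open>0 \<le> \<tau>\<close> \<open>0 \<le> T\<close>
    by (simp add: admissible_path_def Let_def at_config_def \<Gamma>'_def)
  moreover have "((\<lambda>t. 1 + \<mu>\<^sub>L * ctrl_L \<Gamma>' t + \<mu>\<^sub>R * ctrl_R \<Gamma>' t) has_integral
      J + \<tau> * (1 + \<mu>\<^sub>L * v\<^sub>L + \<mu>\<^sub>R * v\<^sub>R)) {0..T + \<tau>}"
  proof (rule has_integral_combine[of 0 T])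
    show "((\<lambda>t. 1 + \<mu>\<^sub>L * ctrl_L \<Gamma>' t + \<mu>\<^sub>R * ctrl_R \<Gamma>' t) has_integral J) {0..T}"
      by (rule has_integral_eq[OF _ J[folded T_def]]) (simp add: \<Gamma>'_def)
    have "((\<lambda>t. 1 + \<mu>\<^sub>L * v\<^sub>L + \<mu>\<^sub>R * v\<^sub>R) has_integral \<tau> * (1 + \<mu>\<^sub>L * v\<^sub>L + \<mu>\<^sub>R * v\<^sub>R)) {T..T + \<tau>}"
      using has_integral_const_real[of "1 + \<mu>\<^sub>L * v\<^sub>L + \<mu>\<^sub>R * v\<^sub>R" T "T + \<tau>"] \<open>0 \<le> \<tau>\<close> by simp
    then show "((\<lambda>t. 1 + \<mu>\<^sub>L * ctrl_L \<Gamma>' t + \<mu>\<^sub>R * ctrl_R \<Gamma>' t) has_integral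
        \<tau> * (1 + \<mu>\<^sub>L * v\<^sub>L + \<mu>\<^sub>R * v\<^sub>R)) {T..T + \<tau>}"
      by (rule has_integral_spike[of "{T}", rotated 2]) (auto simp: \<Gamma>'_def)
  qed (use \<open>0 \<le> \<tau>\<close> \<open>0 \<le> T\<close> in auto)
  moreover have "final_time \<Gamma>' = T + \<tau>" by (simp add: \<Gamma>'_def)
  ultimately show ?thesis
    unfolding reaches_def using final by (intro exI[of _ \<Gamma>']) auto
qed

lemma path_cost_eq:
  assumes adm: "admissible_path U\<^sub>L U\<^sub>R c\<^sub>i c\<^sub>f \<Gamma>" and "0 \<le> \<mu>\<^sub>L" "0 \<le> \<mu>\<^sub>R"
    and J: "((\<lambda>t. 1 + \<mu>\<^sub>L * ctrl_L \<Gamma> t + \<mu>\<^sub>R * ctrl_R \<Gamma> t) has_integral J) {0..final_time \<Gamma>}"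
  shows "path_cost \<mu>\<^sub>L \<mu>\<^sub>R \<Gamma> = J"
proof -
  have "(\<lambda>t. 1 + \<mu>\<^sub>L * ctrl_L \<Gamma> t + \<mu>\<^sub>R * ctrl_R \<Gamma> t) absolutely_integrable_on {0..final_time \<Gamma>}"
  proof (rule nonnegative_absolutely_integrable_1)
    fix t assume "t \<in> {0..final_time \<Gamma>}"
    then have "0 \<le> ctrl_L \<Gamma> t" "0 \<le> ctrl_R \<Gamma> t"
      using adm by (auto simp: admissible_path_def Let_def)
    then show "0 \<le> 1 + \<mu>\<^sub>L * ctrl_L \<Gamma> t + \<mu>\<^sub>R * ctrl_R \<Gamma> t"
      using assms(2,3) by simp
  qed (use J in blast)
  then have "integrable (lebesgue_on {0..final_time \<Gamma>}) (\<lambda>t. 1 + \<mu>\<^sub>L * ctrl_L \<Gamma> t + \<mu>\<^sub>R * ctrl_R \<Gamma> t)"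
    by (simp add: integrable_restrict_space set_integrable_def)
  then show ?thesis
    unfolding path_cost_def using J by (simp add: lebesgue_integral_eq_integral integral_unique)
qed

definition turn_rate :: "real \<Rightarrow> real \<Rightarrow> turn \<Rightarrow> real" where
  "turn_rate U\<^sub>L U\<^sub>R X = fst (turn_control U\<^sub>L U\<^sub>R X) - snd (turn_control U\<^sub>L U\<^sub>R X)"

definition turn_cost :: "real \<Rightarrow> real \<Rightarrow> real \<Rightarrow> real \<Rightarrow> turn \<Rightarrow> real" where
  "turn_cost U\<^sub>L U\<^sub>R \<mu>\<^sub>L \<mu>\<^sub>R X =
     1 + \<mu>\<^sub>L * fst (turn_control U\<^sub>L U\<^sub>R X) + \<mu>\<^sub>R * snd (turn_control U\<^sub>L U\<^sub>R X)"

lemma segment_has_integral: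
  assumes "is_segment U\<^sub>L U\<^sub>R \<Gamma> X a b" "a \<le> b"
  shows "((\<lambda>t. \<phi> (ctrl_L \<Gamma> t) (ctrl_R \<Gamma> t)) has_integral
      (b - a) * \<phi> (fst (turn_control U\<^sub>L U\<^sub>R X)) (snd (turn_control U\<^sub>L U\<^sub>R X))) {a..b}"
proof (rule has_integral_spike)
  show "negligible {t \<in> {a..b}. (ctrl_L \<Gamma> t, ctrl_R \<Gamma> t) \<noteq> turn_control U\<^sub>L U\<^sub>R X}"
    using assms(1) by (simp add: is_segment_def AE_lebesgue_on_iff_negligible)
  show "((\<lambda>t. \<phi> (fst (turn_control U\<^sub>L U\<^sub>R X)) (snd (turn_control U\<^sub>L U\<^sub>R X))) has_integral
      (b - a) * \<phi> (fst (turn_control U\<^sub>L U\<^sub>R X)) (snd (turn_control U\<^sub>L U\<^sub>R X))) {a..b}"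
    using has_integral_const_real[of "\<phi> (fst (turn_control U\<^sub>L U\<^sub>R X)) (snd (turn_control U\<^sub>L U\<^sub>R X))" a b] assms(2) by simp
next
  fix t assume "t \<in> {a..b} - {t \<in> {a..b}. (ctrl_L \<Gamma> t, ctrl_R \<Gamma> t) \<noteq> turn_control U\<^sub>L U\<^sub>R X}"
  then have "(ctrl_L \<Gamma> t, ctrl_R \<Gamma> t) = turn_control U\<^sub>L U\<^sub>R X" by blast
  then show "\<phi> (ctrl_L \<Gamma> t) (ctrl_R \<Gamma> t) = \<phi> (fst (turn_control U\<^sub>L U\<^sub>R X)) (snd (turn_control U\<^sub>L U\<^sub>R X))"
    by (metis fst_conv snd_conv)
qed

lemma is_segment_subset:
  assumes "is_segment U\<^sub>L U\<^sub>R \<Gamma> X a b" "{c..d} \<subseteq> {a..b}"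
  shows "is_segment U\<^sub>L U\<^sub>R \<Gamma> X c d"
  using assms unfolding is_segment_def
  by (auto simp: AE_lebesgue_on_iff_negligible elim!: negligible_subset)

lemma segment_heading:
  assumes "ac_solution_on 0 T (heading \<Gamma>) (\<lambda>t. ctrl_L \<Gamma> t - ctrl_R \<Gamma> t)"
    and "is_segment U\<^sub>L U\<^sub>R \<Gamma> X a b" "0 \<le> a" "b \<le> T" "t \<in> {a..b}"
  shows "heading \<Gamma> t = heading \<Gamma> a + turn_rate U\<^sub>L U\<^sub>R X * (t - a)"
proof -
  have 1: "((\<lambda>t. ctrl_L \<Gamma> t - ctrl_R \<Gamma> t) has_integral (heading \<Gamma> t - heading \<Gamma> a)) {a..t}"
    by (rule ac_solution_on_has_integral, rule ac_solution_on_subset[OF assms(1)]) (use assms in auto)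
  have "is_segment U\<^sub>L U\<^sub>R \<Gamma> X a t"
    by (rule is_segment_subset[OF assms(2)]) (use assms in auto)
  then have 2: "((\<lambda>t. ctrl_L \<Gamma> t - ctrl_R \<Gamma> t) has_integral ((t - a) * turn_rate U\<^sub>L U\<^sub>R X)) {a..t}"
    unfolding turn_rate_def
    using segment_has_integral[where \<phi>="\<lambda>u v. u - v"] assms(5) by auto
  show ?thesis
    using has_integral_unique[OF 1 2] by (simp add: mult.commute)
qed

lemma segment_position:
  assumes "ac_solution_on 0 T (heading \<Gamma>) (\<lambda>t. ctrl_L \<Gamma> t - ctrl_R \<Gamma> t)"
    and "is_segment U\<^sub>L U\<^sub>R \<Gamma> X a b" "0 \<le> a" "a \<le> b" "b \<le> T"
  shows "ac_solution_on 0 T (pos_x \<Gamma>) (\<lambda>t. cos (heading \<Gamma> t)) \<Longrightarrow>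
      pos_x \<Gamma> b = pos_x \<Gamma> a + arc_x (turn_rate U\<^sub>L U\<^sub>R X) (heading \<Gamma> a) (b - a)"
    and "ac_solution_on 0 T (pos_y \<Gamma>) (\<lambda>t. sin (heading \<Gamma> t)) \<Longrightarrow>
      pos_y \<Gamma> b = pos_y \<Gamma> a + arc_y (turn_rate U\<^sub>L U\<^sub>R X) (heading \<Gamma> a) (b - a)"
proof -
  note h = segment_heading[OF assms(1,2,3,5)]
  let ?w = "turn_rate U\<^sub>L U\<^sub>R X"
  {
    assume ac: "ac_solution_on 0 T (pos_x \<Gamma>) (\<lambda>t. cos (heading \<Gamma> t))"
    have 1: "((\<lambda>t. cos (heading \<Gamma> t)) has_integral (pos_x \<Gamma> b - pos_x \<Gamma> a)) {a..b}"
      by (rule ac_solution_on_has_integral, rule ac_solution_on_subset[OF ac]) (use assms in auto)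
    have eq: "cos (heading \<Gamma> a + ?w * (t - a)) = cos (heading \<Gamma> t)" if "t \<in> {a..b}" for t
      by (rule arg_cong[of _ _ cos], rule h[symmetric, OF that])
    have "((\<lambda>t. cos (heading \<Gamma> a + ?w * (t - a))) has_integral
        (0 + arc_x ?w (heading \<Gamma> a) (b - a)) - (0 + arc_x ?w (heading \<Gamma> a) (a - a))) {a..b}"
      by (rule fundamental_theorem_of_calculus[OF assms(4)],
          rule arc_x_deriv[unfolded has_real_derivative_iff_has_vector_derivative])
    then have 2: "((\<lambda>t. cos (heading \<Gamma> t)) has_integral
        (0 + arc_x ?w (heading \<Gamma> a) (b - a)) - (0 + arc_x ?w (heading \<Gamma> a) (a - a))) {a..b}"
      by (rule has_integral_eq[rotated]) (rule eq)
    show "pos_x \<Gamma> b = pos_x \<Gamma> a + arc_x ?w (heading \<Gamma> a) (b - a)"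
      using has_integral_unique[OF 1 2] by simp
  }
  {
    assume ac: "ac_solution_on 0 T (pos_y \<Gamma>) (\<lambda>t. sin (heading \<Gamma> t))"
    have 1: "((\<lambda>t. sin (heading \<Gamma> t)) has_integral (pos_y \<Gamma> b - pos_y \<Gamma> a)) {a..b}"
      by (rule ac_solution_on_has_integral, rule ac_solution_on_subset[OF ac]) (use assms in auto)
    have eq: "sin (heading \<Gamma> a + ?w * (t - a)) = sin (heading \<Gamma> t)" if "t \<in> {a..b}" for t
      by (rule arg_cong[of _ _ sin], rule h[symmetric, OF that])
    have "((\<lambda>t. sin (heading \<Gamma> a + ?w * (t - a))) has_integral
        (0 + arc_y ?w (heading \<Gamma> a) (b - a)) - (0 + arc_y ?w (heading \<Gamma> a) (a - a))) {a..b}"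
      by (rule fundamental_theorem_of_calculus[OF assms(4)],
          rule arc_y_deriv[unfolded has_real_derivative_iff_has_vector_derivative])
    then have 2: "((\<lambda>t. sin (heading \<Gamma> t)) has_integral
        (0 + arc_y ?w (heading \<Gamma> a) (b - a)) - (0 + arc_y ?w (heading \<Gamma> a) (a - a))) {a..b}"
      by (rule has_integral_eq[rotated]) (rule eq)
    show "pos_y \<Gamma> b = pos_y \<Gamma> a + arc_y ?w (heading \<Gamma> a) (b - a)"
      using has_integral_unique[OF 1 2] by simp
  }
qed

section \<open>Half turns and their shortcut\<close>

lemma half_turn_angle:
  fixes A \<phi> w \<tau> :: real
  assumes "w \<noteq> 0" "\<tau> > 0" "cos (A - \<phi>) = 0" "cos (A + w * \<tau> - \<phi>) = 0"
    and nonneg: "\<And>s. s \<in> {0..\<tau>} \<Longrightarrow> 0 \<le> cos (A + w * s - \<phi>)"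
  shows "\<bar>w\<bar> * \<tau> = pi"
proof -
  define c where "c = - sgn w * sin (A - \<phi>)"
  have eq: "cos (A + w * s - \<phi>) = c * sin (\<bar>w\<bar> * s)" for s
  proof -
    have "cos (A + w * s - \<phi>) = cos ((A - \<phi>) + w * s)" by (simp add: algebra_simps)
    also have "\<dots> = - sin (A - \<phi>) * sin (w * s)" using assms(3) by (simp add: cos_add)
    also have "\<dots> = c * sin (\<bar>w\<bar> * s)"
      by (cases "w > 0") (use \<open>w \<noteq> 0\<close> in \<open>auto simp: c_def sgn_if\<close>)
    finally show ?thesis .
  qed
  have "sin (A - \<phi>) \<noteq> 0"
    using assms(3) sin_cos_squared_add[of "A - \<phi>"] by auto
  then have "c \<noteq> 0" using \<open>w \<noteq> 0\<close> by (simp add: c_def sgn_if)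
  have csin: "0 \<le> c * sin \<theta>" if "0 \<le> \<theta>" "\<theta> \<le> \<bar>w\<bar> * \<tau>" for \<theta>
    using nonneg[of "\<theta> / \<bar>w\<bar>"] eq[of "\<theta> / \<bar>w\<bar>"] that \<open>w \<noteq> 0\<close> by (simp add: field_simps)
  have pos: "0 < \<bar>w\<bar> * \<tau>" using assms by simp
  have "0 < sin (min (\<bar>w\<bar> * \<tau>) (pi / 2))"
    using pos by (intro sin_gt_zero) (auto simp: min_def intro: le_less_trans[of _ "pi/2"])
  moreover have "0 \<le> c * sin (min (\<bar>w\<bar> * \<tau>) (pi / 2))"
    using pos by (intro csin) auto
  ultimately have "c > 0" using \<open>c \<noteq> 0\<close> by (simp add: zero_le_mult_iff)
  have "sin (\<bar>w\<bar> * \<tau>) = 0" using eq[of \<tau>] assms(4) \<open>c \<noteq> 0\<close> by simp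
  then have "\<not> \<bar>w\<bar> * \<tau> < pi" using pos sin_gt_zero by force
  moreover have "\<not> pi < \<bar>w\<bar> * \<tau>"
  proof
    assume that: "pi < \<bar>w\<bar> * \<tau>"
    let ?\<theta> = "min (\<bar>w\<bar> * \<tau>) (3 * pi / 2)"
    have "sin ?\<theta> < 0"
    proof (rule sin_lt_zero)
      have "pi < 3 * pi / 2" "3 * pi / 2 < 2 * pi" using pi_gt_zero by linarith+
      then show "pi < ?\<theta>" "?\<theta> < 2 * pi" using that by linarith+
    qed
    moreover have "0 \<le> c * sin ?\<theta>" using pos by (intro csin) auto
    ultimately show False using \<open>c > 0\<close> by (simp add: zero_le_mult_iff)
  qed
  ultimately show ?thesis by linarith
qed

lemma one_minus_cos_less:
  fixes \<delta> :: real
  assumes "0 < \<delta>" "\<delta> \<le> 1"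
  shows "1 - cos \<delta> < \<delta>"
proof -
  have "0 \<le> sin (\<delta> / 2)" "sin (\<delta> / 2) \<le> \<delta> / 2"
    using assms pi_gt3 by (intro sin_ge_zero sin_x_le_x; linarith)+
  then have "(sin (\<delta> / 2))\<^sup>2 \<le> (\<delta> / 2)\<^sup>2" by (rule power_mono[rotated])
  then have "1 - cos \<delta> \<le> 2 * (\<delta> / 2)\<^sup>2"
    using cos_double_sin[of "\<delta> / 2"] by simp
  also have "\<dots> = \<delta> * \<delta> / 2" by (simp add: power2_eq_square)
  also have "\<dots> \<le> \<delta> * 1 / 2" using assms by (intro divide_right_mono mult_left_mono) auto
  also have "\<dots> < \<delta>" using assms by simp
  finally show ?thesis .
qed

lemma shortcut_displacement:
  fixes A \<sigma> \<delta> B F w v s :: real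
  assumes \<sigma>: "\<sigma> = 1 \<or> \<sigma> = - 1" and "w \<noteq> 0" "v \<noteq> 0"
    and s: "s = 2 * \<sigma> * (1 / w - 1 / v) * (1 - cos \<delta>)"
  shows "(sin A - sin B) / w + (sin (A - \<sigma> * pi) - sin A) / v + (sin F - sin (A - \<sigma> * pi)) / w =
     (sin (A - \<sigma> * \<delta>) - sin B) / w + (sin (A - \<sigma> * pi / 2) - sin (A - \<sigma> * \<delta>)) / v +
     s * cos (A - \<sigma> * pi / 2) + (sin (A - \<sigma> * pi + \<sigma> * \<delta>) - sin (A - \<sigma> * pi / 2)) / v +
     (sin F - sin (A - \<sigma> * pi + \<sigma> * \<delta>)) / w" (is ?X)
   and "(cos B - cos A) / w + (cos A - cos (A - \<sigma> * pi)) / v + (cos (A - \<sigma> * pi) - cos F) / w =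
     (cos B - cos (A - \<sigma> * \<delta>)) / w + (cos (A - \<sigma> * \<delta>) - cos (A - \<sigma> * pi / 2)) / v +
     s * sin (A - \<sigma> * pi / 2) + (cos (A - \<sigma> * pi / 2) - cos (A - \<sigma> * pi + \<sigma> * \<delta>)) / v +
     (cos (A - \<sigma> * pi + \<sigma> * \<delta>) - cos F) / w" (is ?Y)
proof -
  have tr: "sin (A - \<sigma> * pi) = - sin A" "cos (A - \<sigma> * pi) = - cos A"
    "sin (A - \<sigma> * pi / 2) = - (\<sigma> * cos A)" "cos (A - \<sigma> * pi / 2) = \<sigma> * sin A"
    "sin (A - \<sigma> * \<delta>) = sin A * cos \<delta> - \<sigma> * cos A * sin \<delta>"
    "cos (A - \<sigma> * \<delta>) = cos A * cos \<delta> + \<sigma> * sin A * sin \<delta>"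
    using \<sigma> by (auto simp: sin_diff cos_diff sin_add cos_add)
  have tr': "sin (A - \<sigma> * pi + \<sigma> * \<delta>) = - (sin A * cos \<delta> + \<sigma> * cos A * sin \<delta>)"
    "cos (A - \<sigma> * pi + \<sigma> * \<delta>) = - (cos A * cos \<delta> - \<sigma> * sin A * sin \<delta>)"
    using \<sigma> unfolding sin_add cos_add tr by auto
  have "\<sigma> * \<sigma> = 1" using \<sigma> by auto
  then have s\<sigma>: "s * (\<sigma> * z) = 2 * (1 / w - 1 / v) * (1 - cos \<delta>) * z"
    "s * - (\<sigma> * z) = - 2 * (1 / w - 1 / v) * (1 - cos \<delta>) * z" for z
    unfolding s by algebra+
  show ?X ?Y
    unfolding tr tr' s\<sigma> by (simp_all add: diff_divide_distrib add_divide_distrib algebra_simps)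
qed

lemma multipliers_on_segment:
  assumes "U\<^sub>L > 0" "U\<^sub>R > 0"
    and seg: "is_segment U\<^sub>L U\<^sub>R \<Gamma> X a b" and ab: "0 \<le> a" "a < b" "b \<le> T"
    and \<beta>: "continuous_on {0..T} \<beta>" and h: "continuous_on {0..T} (heading \<Gamma>)"
    and pmp: "AE t in lebesgue_on {0..T}.
              let H = hamiltonian \<mu>\<^sub>L \<mu>\<^sub>R 0 \<Lambda> \<phi> (\<beta> t) (heading \<Gamma> t);
                  u = (ctrl_L \<Gamma> t, ctrl_R \<Gamma> t)
              in is_arg_min H (\<lambda>v. v \<in> {0..U\<^sub>L} \<times> {0..U\<^sub>R}) u \<and> H u = 0"
    and t: "t \<in> {a..b}"
  shows "turn_rate U\<^sub>L U\<^sub>R X * \<beta> t \<le> 0"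
    and "turn_rate U\<^sub>L U\<^sub>R X * \<beta> t + \<Lambda> * cos (heading \<Gamma> t - \<phi>) = 0"
proof -
  let ?w = "turn_rate U\<^sub>L U\<^sub>R X"
  let ?f = "\<lambda>t. (?w * \<beta> t, ?w * \<beta> t + \<Lambda> * cos (heading \<Gamma> t - \<phi>))"
  have sub: "{a..b} \<subseteq> {0..T}" using ab by auto
  have "continuous_on {a..b} ?f"
    by (intro continuous_intros continuous_on_subset[OF \<beta> sub] continuous_on_subset[OF h sub])
  moreover have "AE t in lebesgue_on {a..b}. ?f t \<in> {..0} \<times> {0}"
  proof -
    let ?P = "\<lambda>t. let H = hamiltonian \<mu>\<^sub>L \<mu>\<^sub>R 0 \<Lambda> \<phi> (\<beta> t) (heading \<Gamma> t);
                  u = (ctrl_L \<Gamma> t, ctrl_R \<Gamma> t)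
              in is_arg_min H (\<lambda>v. v \<in> {0..U\<^sub>L} \<times> {0..U\<^sub>R}) u \<and> H u = 0"
    have "negligible {t \<in> {0..T}. \<not> ?P t}"
      using pmp by (subst (asm) AE_lebesgue_on_iff_negligible) auto
    then have "negligible {t \<in> {a..b}. \<not> ?P t}"
      by (rule negligible_subset) (use sub in blast)
    then have "AE t in lebesgue_on {a..b}. ?P t"
      by (subst AE_lebesgue_on_iff_negligible) auto
    then show ?thesis
      using seg unfolding is_segment_def
    proof eventually_elim
      case (elim t)
      define H where "H = hamiltonian \<mu>\<^sub>L \<mu>\<^sub>R 0 \<Lambda> \<phi> (\<beta> t) (heading \<Gamma> t)"
      have *: "is_arg_min H (\<lambda>v. v \<in> {0..U\<^sub>L} \<times> {0..U\<^sub>R}) (turn_control U\<^sub>L U\<^sub>R X)"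
        "H (turn_control U\<^sub>L U\<^sub>R X) = 0"
        using elim by (simp_all add: Let_def H_def)
      have "(0, 0) \<in> {0..U\<^sub>L} \<times> {0..U\<^sub>R}" using assms(1,2) by simp
      then have "\<not> H (0, 0) < 0" using * by (auto simp: is_arg_min_def)
      then show ?case using *(2)
        by (cases X) (auto simp: H_def hamiltonian_def turn_rate_def algebra_simps)
    qed
  qed
  ultimately have "?f t \<in> {..0} \<times> {0}"
    using AE_imp_closed_everywhere[OF \<open>a < b\<close>, of ?f "{..0} \<times> {0}" t] t
    by (auto simp: closed_Times)
  then show "?w * \<beta> t \<le> 0" "?w * \<beta> t + \<Lambda> * cos (heading \<Gamma> t - \<phi>) = 0" by auto
qed

lemma turn_rate_simps [simp]:
  "turn_rate U\<^sub>L U\<^sub>R Left_turn = U\<^sub>L" "turn_rate U\<^sub>L U\<^sub>R Right_turn = - U\<^sub>R"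
  by (simp_all add: turn_rate_def)

lemma reaches_turn:
  assumes "reaches U\<^sub>L U\<^sub>R \<mu>\<^sub>L \<mu>\<^sub>R c x y \<alpha> J" and "0 \<le> \<tau>" and U: "0 < U\<^sub>L" "0 < U\<^sub>R"
    and w: "w = turn_rate U\<^sub>L U\<^sub>R X" and \<alpha>': "\<alpha>' = \<alpha> + w * \<tau>"
  shows "reaches U\<^sub>L U\<^sub>R \<mu>\<^sub>L \<mu>\<^sub>R c (x + (sin \<alpha>' - sin \<alpha>) / w) (y + (cos \<alpha> - cos \<alpha>') / w) \<alpha>'
           (J + \<tau> * turn_cost U\<^sub>L U\<^sub>R \<mu>\<^sub>L \<mu>\<^sub>R X)"
proof -
  have "w \<noteq> 0" using U by (cases X) (auto simp: w)
  then have "x + (sin \<alpha>' - sin \<alpha>) / w = x + arc_x w \<alpha> \<tau>" "y + (cos \<alpha> - cos \<alpha>') / w = y + arc_y w \<alpha> \<tau>"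
    by (simp_all add: arc_x_def arc_y_def \<alpha>')
  then show ?thesis
    unfolding turn_cost_def \<alpha>'
    using reaches_extend[OF assms(1,2), of "fst (turn_control U\<^sub>L U\<^sub>R X)" "snd (turn_control U\<^sub>L U\<^sub>R X)" w] U
    by (cases X) (auto simp: w turn_rate_def)
qed

text \<open>The part \<open>X\<^sub>\<delta> Y\<^sub>\<pi> X\<^sub>\<delta>\<close> of the path around its middle segment is replaced by two arcs \<open>Y\<close> of
  angle \<open>\<pi> / 2 - \<delta>\<close> joined by a straight segment of length \<open>s = 2 (r\<^sub>L + r\<^sub>R) (1 - cos \<delta>)\<close>. The turns
  saved cost at least \<open>2 (r\<^sub>L + r\<^sub>R) \<delta>\<close>, which exceeds \<open>s\<close>.\<close>

lemma half_turn_shortcut: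
  assumes U: "U\<^sub>L > 0" "U\<^sub>R > 0" and \<mu>: "\<mu>\<^sub>L \<ge> 0" "\<mu>\<^sub>R \<ge> 0"
    and adm: "admissible_path U\<^sub>L U\<^sub>R c\<^sub>i c\<^sub>f \<Gamma>"
    and opp: "turn_rate U\<^sub>L U\<^sub>R X * turn_rate U\<^sub>L U\<^sub>R Y < 0"
    and t: "0 < t\<^sub>1" "t\<^sub>1 < t\<^sub>2" "t\<^sub>2 < final_time \<Gamma>"
    and seg: "is_segment U\<^sub>L U\<^sub>R \<Gamma> X 0 t\<^sub>1" "is_segment U\<^sub>L U\<^sub>R \<Gamma> Y t\<^sub>1 t\<^sub>2"
      "is_segment U\<^sub>L U\<^sub>R \<Gamma> X t\<^sub>2 (final_time \<Gamma>)"
    and half: "\<bar>turn_rate U\<^sub>L U\<^sub>R Y\<bar> * (t\<^sub>2 - t\<^sub>1) = pi"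
  shows "\<exists>\<Gamma>'. admissible_path U\<^sub>L U\<^sub>R c\<^sub>i c\<^sub>f \<Gamma>' \<and> path_cost \<mu>\<^sub>L \<mu>\<^sub>R \<Gamma>' < path_cost \<mu>\<^sub>L \<mu>\<^sub>R \<Gamma>"
proof -
  define T where "T = final_time \<Gamma>"
  define w where "w = turn_rate U\<^sub>L U\<^sub>R X"
  define v where "v = turn_rate U\<^sub>L U\<^sub>R Y"
  define cX where "cX = turn_cost U\<^sub>L U\<^sub>R \<mu>\<^sub>L \<mu>\<^sub>R X"
  define cY where "cY = turn_cost U\<^sub>L U\<^sub>R \<mu>\<^sub>L \<mu>\<^sub>R Y"
  define \<sigma> where "\<sigma> = sgn w"
  define A where "A = heading \<Gamma> t\<^sub>1"
  define B where "B = heading \<Gamma> 0"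
  define F where "F = heading \<Gamma> T"
  define \<delta> where "\<delta> = min 1 (min (\<bar>w\<bar> * t\<^sub>1) (\<bar>w\<bar> * (T - t\<^sub>2)))"
  define s where "s = 2 * \<sigma> * (1 / w - 1 / v) * (1 - cos \<delta>)"
  note t = t[folded T_def] and seg = seg[folded T_def]
  have ac: "ac_solution_on 0 T (pos_x \<Gamma>) (\<lambda>t. cos (heading \<Gamma> t))"
    "ac_solution_on 0 T (pos_y \<Gamma>) (\<lambda>t. sin (heading \<Gamma> t))"
    "ac_solution_on 0 T (heading \<Gamma>) (\<lambda>t. ctrl_L \<Gamma> t - ctrl_R \<Gamma> t)"
    and ends: "at_config \<Gamma> 0 c\<^sub>i" "at_config \<Gamma> T c\<^sub>f"
    using adm unfolding admissible_path_def T_def by (auto simp: Let_def)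
  have "w \<noteq> 0" "v \<noteq> 0" using opp by (auto simp: w_def v_def)
  then have "(\<sigma> = 1 \<and> w > 0 \<and> v < 0) \<or> (\<sigma> = - 1 \<and> w < 0 \<and> v > 0)"
    using opp by (auto simp: w_def v_def \<sigma>_def mult_less_0_iff)
  then have \<sigma>: "\<sigma> = 1 \<or> \<sigma> = - 1" and w\<sigma>: "w = \<sigma> * \<bar>w\<bar>" "w / \<bar>w\<bar> = \<sigma>"
    and v\<sigma>: "v = - \<sigma> * \<bar>v\<bar>" "v / \<bar>v\<bar> = - \<sigma>" and \<sigma>inv: "\<sigma> * (1 / w - 1 / v) = 1 / \<bar>w\<bar> + 1 / \<bar>v\<bar>"
    by auto
  have \<delta>: "0 < \<delta>" "\<delta> \<le> 1" "\<delta> \<le> \<bar>w\<bar> * t\<^sub>1" "\<delta> \<le> \<bar>w\<bar> * (T - t\<^sub>2)"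
    using t \<open>w \<noteq> 0\<close> by (auto simp: \<delta>_def)
  have "\<delta> < pi / 2" using \<delta>(2) pi_gt3 by linarith
  have s_eq: "s = 2 * (1 / \<bar>w\<bar> + 1 / \<bar>v\<bar>) * (1 - cos \<delta>)"
    unfolding s_def \<sigma>inv[symmetric] by simp
  have \<tau>: "0 \<le> t\<^sub>1 - \<delta> / \<bar>w\<bar>" "0 \<le> (pi / 2 - \<delta>) / \<bar>v\<bar>" "0 \<le> T - t\<^sub>2 - \<delta> / \<bar>w\<bar>"
    using \<delta> \<open>\<delta> < pi / 2\<close> \<open>w \<noteq> 0\<close> by (auto simp: field_simps)
  have "0 \<le> s" unfolding s_eq by (intro mult_nonneg_nonneg) auto
  have A: "A = B + w * t\<^sub>1"
    using segment_heading[OF ac(3) seg(1), of t\<^sub>1] t by (simp add: A_def B_def w_def)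
  have A2: "heading \<Gamma> t\<^sub>2 = A - \<sigma> * pi"
  proof -
    have "heading \<Gamma> t\<^sub>2 = A + v * (t\<^sub>2 - t\<^sub>1)"
      using segment_heading[OF ac(3) seg(2), of t\<^sub>2] t by (simp add: A_def v_def)
    also have "v * (t\<^sub>2 - t\<^sub>1) = - \<sigma> * (\<bar>v\<bar> * (t\<^sub>2 - t\<^sub>1))" by (subst v\<sigma>(1)) simp
    finally show ?thesis using half by (simp add: v_def)
  qed
  have F: "F = A - \<sigma> * pi + w * (T - t\<^sub>2)"
    using segment_heading[OF ac(3) seg(3), of T] t by (simp add: A2 F_def w_def)
  have x: "pos_x \<Gamma> T = pos_x \<Gamma> 0 + ((sin A - sin B) / w + (sin (A - \<sigma> * pi) - sin A) / v + (sin F - sin (A - \<sigma> * pi)) / w)"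
    and y: "pos_y \<Gamma> T = pos_y \<Gamma> 0 + ((cos B - cos A) / w + (cos A - cos (A - \<sigma> * pi)) / v + (cos (A - \<sigma> * pi) - cos F) / w)"
  proof -
    have e: "heading \<Gamma> 0 + w * (t\<^sub>1 - 0) = A" "heading \<Gamma> t\<^sub>1 + v * (t\<^sub>2 - t\<^sub>1) = A - \<sigma> * pi"
      "heading \<Gamma> t\<^sub>2 + w * (T - t\<^sub>2) = F"
      using A F A2 segment_heading[OF ac(3) seg(2), of t\<^sub>2] t by (simp_all add: B_def v_def)
    note px = segment_position(1)[OF ac(3) seg(1) _ _ _ ac(1)] segment_position(1)[OF ac(3) seg(2) _ _ _ ac(1)]
      segment_position(1)[OF ac(3) seg(3) _ _ _ ac(1)]
    note py = segment_position(2)[OF ac(3) seg(1) _ _ _ ac(2)] segment_position(2)[OF ac(3) seg(2) _ _ _ ac(2)]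
      segment_position(2)[OF ac(3) seg(3) _ _ _ ac(2)]
    show "pos_x \<Gamma> T = pos_x \<Gamma> 0 + ((sin A - sin B) / w + (sin (A - \<sigma> * pi) - sin A) / v + (sin F - sin (A - \<sigma> * pi)) / w)"
      using px t \<open>w \<noteq> 0\<close> \<open>v \<noteq> 0\<close>
      unfolding arc_x_def w_def[symmetric] v_def[symmetric] e by (simp add: A2 A_def[symmetric] B_def[symmetric])
    show "pos_y \<Gamma> T = pos_y \<Gamma> 0 + ((cos B - cos A) / w + (cos A - cos (A - \<sigma> * pi)) / v + (cos (A - \<sigma> * pi) - cos F) / w)"
      using py t \<open>w \<noteq> 0\<close> \<open>v \<noteq> 0\<close>
      unfolding arc_y_def w_def[symmetric] v_def[symmetric] e by (simp add: A2 A_def[symmetric] B_def[symmetric])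
  qed
  have turn_cost_integral: "((\<lambda>t. 1 + \<mu>\<^sub>L * ctrl_L \<Gamma> t + \<mu>\<^sub>R * ctrl_R \<Gamma> t) has_integral
      (b - a) * turn_cost U\<^sub>L U\<^sub>R \<mu>\<^sub>L \<mu>\<^sub>R Z) {a..b}"
    if "is_segment U\<^sub>L U\<^sub>R \<Gamma> Z a b" "a \<le> b" for Z a b
    unfolding turn_cost_def
    using segment_has_integral[OF that, where \<phi>="\<lambda>u v. 1 + \<mu>\<^sub>L * u + \<mu>\<^sub>R * v"] .
  have "((\<lambda>t. 1 + \<mu>\<^sub>L * ctrl_L \<Gamma> t + \<mu>\<^sub>R * ctrl_R \<Gamma> t) has_integral
      ((t\<^sub>1 - 0) * cX + (t\<^sub>2 - t\<^sub>1) * cY) + (T - t\<^sub>2) * cX) {0..T}"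
    unfolding cX_def cY_def
    by (intro has_integral_combine[of 0 t\<^sub>2 T] has_integral_combine[of 0 t\<^sub>1 t\<^sub>2] turn_cost_integral seg)
      (use t in auto)
  then have cost: "path_cost \<mu>\<^sub>L \<mu>\<^sub>R \<Gamma> = t\<^sub>1 * cX + (t\<^sub>2 - t\<^sub>1) * cY + (T - t\<^sub>2) * cX"
    using path_cost_eq[OF adm \<mu>] by (simp add: T_def)
  obtain x\<^sub>0 y\<^sub>0 \<alpha>\<^sub>0 where ci: "c\<^sub>i = (x\<^sub>0, y\<^sub>0, \<alpha>\<^sub>0)" by (cases c\<^sub>i)
  have r0: "reaches U\<^sub>L U\<^sub>R \<mu>\<^sub>L \<mu>\<^sub>R c\<^sub>i (pos_x \<Gamma> 0) (pos_y \<Gamma> 0) B 0"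
    using ends(1) U reaches_start[of U\<^sub>L U\<^sub>R B \<alpha>\<^sub>0] by (auto simp: ci at_config_def B_def)
  have h: "A - \<sigma> * \<delta> = B + w * (t\<^sub>1 - \<delta> / \<bar>w\<bar>)"
    "A - \<sigma> * pi / 2 = A - \<sigma> * \<delta> + v * ((pi / 2 - \<delta>) / \<bar>v\<bar>)"
    "A - \<sigma> * pi + \<sigma> * \<delta> = A - \<sigma> * pi / 2 + 0 * s + v * ((pi / 2 - \<delta>) / \<bar>v\<bar>)"
    "F = A - \<sigma> * pi + \<sigma> * \<delta> + w * (T - t\<^sub>2 - \<delta> / \<bar>w\<bar>)"
  proof -
    have 1: "w * (z - \<delta> / \<bar>w\<bar>) = w * z - \<sigma> * \<delta>" for z
      by (subst w\<sigma>(2)[symmetric]) (simp add: right_diff_distrib)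
    have 2: "v * ((pi / 2 - \<delta>) / \<bar>v\<bar>) = - \<sigma> * (pi / 2 - \<delta>)"
      by (subst v\<sigma>(2)[symmetric]) simp
    show "A - \<sigma> * \<delta> = B + w * (t\<^sub>1 - \<delta> / \<bar>w\<bar>)"
      "A - \<sigma> * pi / 2 = A - \<sigma> * \<delta> + v * ((pi / 2 - \<delta>) / \<bar>v\<bar>)"
      "A - \<sigma> * pi + \<sigma> * \<delta> = A - \<sigma> * pi / 2 + 0 * s + v * ((pi / 2 - \<delta>) / \<bar>v\<bar>)"
      "F = A - \<sigma> * pi + \<sigma> * \<delta> + w * (T - t\<^sub>2 - \<delta> / \<bar>w\<bar>)"
      unfolding 1 2 by (simp_all add: A F algebra_simps)
  qed
  note r1 = reaches_turn[OF r0 \<tau>(1) U w_def h(1), folded cX_def]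
  note r2 = reaches_turn[OF r1 \<tau>(2) U v_def h(2), folded cY_def]
  note r3 = reaches_extend[OF r2 \<open>0 \<le> s\<close>, of 0 0 0]
  have r3': "reaches U\<^sub>L U\<^sub>R \<mu>\<^sub>L \<mu>\<^sub>R c\<^sub>i
     (pos_x \<Gamma> 0 + (sin (A - \<sigma> * \<delta>) - sin B) / w + (sin (A - \<sigma> * pi / 2) - sin (A - \<sigma> * \<delta>)) / v
        + s * cos (A - \<sigma> * pi / 2))
     (pos_y \<Gamma> 0 + (cos B - cos (A - \<sigma> * \<delta>)) / w + (cos (A - \<sigma> * \<delta>) - cos (A - \<sigma> * pi / 2)) / v
        + s * sin (A - \<sigma> * pi / 2)) (A - \<sigma> * pi / 2 + 0 * s)
     (0 + (t\<^sub>1 - \<delta> / \<bar>w\<bar>) * cX + (pi / 2 - \<delta>) / \<bar>v\<bar> * cY + s)"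
    using r3 U by (simp add: arc_x_def arc_y_def)
  note r4 = reaches_turn[OF r3' \<tau>(2) U v_def h(3), folded cY_def]
  note r5 = reaches_turn[OF r4 \<tau>(3) U w_def h(4), folded cX_def]
  define J where "J = (0 + (t\<^sub>1 - \<delta> / \<bar>w\<bar>) * cX + (pi / 2 - \<delta>) / \<bar>v\<bar> * cY + s) + (pi / 2 - \<delta>) / \<bar>v\<bar> * cY
      + (T - t\<^sub>2 - \<delta> / \<bar>w\<bar>) * cX"
  have "reaches U\<^sub>L U\<^sub>R \<mu>\<^sub>L \<mu>\<^sub>R c\<^sub>i (pos_x \<Gamma> T) (pos_y \<Gamma> T) F J"
    using r5 unfolding x y shortcut_displacement[OF \<sigma> \<open>w \<noteq> 0\<close> \<open>v \<noteq> 0\<close> s_def] J_def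
    by (simp add: add.assoc)
  then obtain \<Gamma>' where adm': "admissible_path U\<^sub>L U\<^sub>R c\<^sub>i (pos_x \<Gamma> T, pos_y \<Gamma> T, F) \<Gamma>'"
    and F': "heading \<Gamma>' (final_time \<Gamma>') = F"
    and J: "((\<lambda>t. 1 + \<mu>\<^sub>L * ctrl_L \<Gamma>' t + \<mu>\<^sub>R * ctrl_R \<Gamma>' t) has_integral J) {0..final_time \<Gamma>'}"
    unfolding reaches_def by blast
  have "admissible_path U\<^sub>L U\<^sub>R c\<^sub>i c\<^sub>f \<Gamma>'"
    using adm' ends(2) F' by (cases c\<^sub>f) (auto simp: admissible_path_def Let_def at_config_def F_def)
  moreover have "path_cost \<mu>\<^sub>L \<mu>\<^sub>R \<Gamma>' < path_cost \<mu>\<^sub>L \<mu>\<^sub>R \<Gamma>"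
  proof -
    have "1 \<le> turn_cost U\<^sub>L U\<^sub>R \<mu>\<^sub>L \<mu>\<^sub>R Z" for Z
      using U \<mu> by (cases Z) (auto simp: turn_cost_def)
    then have c: "1 \<le> cX" "1 \<le> cY" by (simp_all add: cX_def cY_def)
    have half': "t\<^sub>2 - t\<^sub>1 = pi / \<bar>v\<bar>" using half \<open>v \<noteq> 0\<close> by (simp add: v_def field_simps)
    have "s < 2 * (1 / \<bar>w\<bar> + 1 / \<bar>v\<bar>) * \<delta>"
      unfolding s_eq using one_minus_cos_less[OF \<delta>(1,2)] \<open>w \<noteq> 0\<close> \<open>v \<noteq> 0\<close>
      by (intro mult_strict_left_mono) (auto simp: add_pos_pos)
    also have "\<dots> = 2 * (\<delta> / \<bar>w\<bar> * 1 + \<delta> / \<bar>v\<bar> * 1)" by (simp add: field_simps)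
    also have "\<dots> \<le> 2 * (\<delta> / \<bar>w\<bar> * cX + \<delta> / \<bar>v\<bar> * cY)"
      using c \<delta> by (intro mult_left_mono add_mono) auto
    finally have "s < 2 * (\<delta> / \<bar>w\<bar> * cX + \<delta> / \<bar>v\<bar> * cY)" .
    moreover have "J = t\<^sub>1 * cX + (t\<^sub>2 - t\<^sub>1) * cY + (T - t\<^sub>2) * cX
        - 2 * (\<delta> / \<bar>w\<bar> * cX + \<delta> / \<bar>v\<bar> * cY) + s"
      unfolding J_def half' by (simp add: algebra_simps diff_divide_distrib)
    ultimately show ?thesis
      unfolding cost path_cost_eq[OF adm' \<mu> J] by linarith
  qed
  ultimately show ?thesis by blast
qed

text \<open>If \<open>e = 0\<close>, the sign of \<open>\<beta>\<close> changes at every switch, so \<open>\<beta>\<close> and hence \<open>cos (\<alpha> - \<phi>)\<close> vanish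
  there, while \<open>cos (\<alpha> - \<phi>) \<ge> 0\<close> along the path.\<close>

lemma abnormal_half_turn:
  assumes U: "U\<^sub>L > 0" "U\<^sub>R > 0"
    and adm: "admissible_path U\<^sub>L U\<^sub>R c\<^sub>i c\<^sub>f \<Gamma>"
    and pm: "pontryagin_multipliers U\<^sub>L U\<^sub>R \<mu>\<^sub>L \<mu>\<^sub>R \<Gamma> 0 p q \<beta>"
    and opp: "turn_rate U\<^sub>L U\<^sub>R X * turn_rate U\<^sub>L U\<^sub>R Y < 0"
    and t: "0 < t\<^sub>1" "t\<^sub>1 < t\<^sub>2" "t\<^sub>2 < final_time \<Gamma>"
    and seg: "is_segment U\<^sub>L U\<^sub>R \<Gamma> X 0 t\<^sub>1" "is_segment U\<^sub>L U\<^sub>R \<Gamma> Y t\<^sub>1 t\<^sub>2"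
      "is_segment U\<^sub>L U\<^sub>R \<Gamma> X t\<^sub>2 (final_time \<Gamma>)"
  shows "\<bar>turn_rate U\<^sub>L U\<^sub>R Y\<bar> * (t\<^sub>2 - t\<^sub>1) = pi"
proof -
  define T where "T = final_time \<Gamma>"
  define w where "w = turn_rate U\<^sub>L U\<^sub>R X"
  define v where "v = turn_rate U\<^sub>L U\<^sub>R Y"
  define \<Lambda> where "\<Lambda> = sqrt (p\<^sup>2 + q\<^sup>2)"
  note t = t[folded T_def] and seg = seg[folded T_def]
  obtain \<phi> where nontriv: "\<not> (p = 0 \<and> q = 0 \<and> (\<forall>t\<in>{0..T}. \<beta> t = 0))"
    and \<beta>: "ac_solution_on 0 T \<beta> (\<lambda>t. \<Lambda> * sin (heading \<Gamma> t - \<phi>))"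
    and pmp: "AE t in lebesgue_on {0..T}.
              let H = hamiltonian \<mu>\<^sub>L \<mu>\<^sub>R 0 \<Lambda> \<phi> (\<beta> t) (heading \<Gamma> t);
                  u = (ctrl_L \<Gamma> t, ctrl_R \<Gamma> t)
              in is_arg_min H (\<lambda>v. v \<in> {0..U\<^sub>L} \<times> {0..U\<^sub>R}) u \<and> H u = 0"
    using pm unfolding pontryagin_multipliers_def T_def \<Lambda>_def by (auto simp: Let_def)
  have ac: "ac_solution_on 0 T (heading \<Gamma>) (\<lambda>t. ctrl_L \<Gamma> t - ctrl_R \<Gamma> t)"
    using adm unfolding admissible_path_def T_def by (auto simp: Let_def)
  note m = multipliers_on_segment[OF U _ _ _ _ ac_solution_on_continuous[OF \<beta>] ac_solution_on_continuous[OF ac] pmp]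
  have m1: "w * \<beta> t \<le> 0" "w * \<beta> t + \<Lambda> * cos (heading \<Gamma> t - \<phi>) = 0" if "t \<in> {0..t\<^sub>1}" for t
    using m[OF seg(1)] t that by (auto simp: w_def)
  have m2: "v * \<beta> t \<le> 0" "v * \<beta> t + \<Lambda> * cos (heading \<Gamma> t - \<phi>) = 0" if "t \<in> {t\<^sub>1..t\<^sub>2}" for t
    using m[OF seg(2)] t that by (auto simp: v_def)
  have m3: "w * \<beta> t \<le> 0" "w * \<beta> t + \<Lambda> * cos (heading \<Gamma> t - \<phi>) = 0" if "t \<in> {t\<^sub>2..T}" for t
    using m[OF seg(3)] t that by (auto simp: w_def)
  have "w \<noteq> 0" "v \<noteq> 0" and sgn: "(w > 0 \<and> v < 0) \<or> (w < 0 \<and> v > 0)"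
    using opp by (auto simp: w_def v_def mult_less_0_iff)
  have "\<Lambda> > 0"
  proof (rule ccontr)
    assume "\<not> \<Lambda> > 0"
    then have "\<Lambda> \<le> 0" by simp
    then have "p\<^sup>2 + q\<^sup>2 \<le> 0" by (simp add: \<Lambda>_def)
    then have "p = 0" "q = 0" by (simp_all add: sum_power2_le_zero_iff)
    then have "\<Lambda> = 0" by (simp add: \<Lambda>_def)
    have "\<beta> t = 0" if tT: "t \<in> {0..T}" for t
    proof -
      have "t \<in> {0..t\<^sub>1} \<or> t \<in> {t\<^sub>1..t\<^sub>2} \<or> t \<in> {t\<^sub>2..T}" using tT by auto
      then show ?thesis
        using m1(2)[of t] m2(2)[of t] m3(2)[of t] \<open>\<Lambda> = 0\<close> \<open>w \<noteq> 0\<close> \<open>v \<noteq> 0\<close> by (elim disjE) auto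
    qed
    then show False using nontriv \<open>p = 0\<close> \<open>q = 0\<close> by blast
  qed
  have "\<beta> t\<^sub>1 = 0"
    using m1(1)[of t\<^sub>1] m2(1)[of t\<^sub>1] t sgn by (auto simp: mult_le_0_iff)
  moreover have "\<beta> t\<^sub>2 = 0"
    using m3(1)[of t\<^sub>2] m2(1)[of t\<^sub>2] t sgn by (auto simp: mult_le_0_iff)
  ultimately have cos0: "cos (heading \<Gamma> t\<^sub>1 - \<phi>) = 0" "cos (heading \<Gamma> t\<^sub>2 - \<phi>) = 0"
    using m2(2)[of t\<^sub>1] m2(2)[of t\<^sub>2] t \<open>\<Lambda> > 0\<close> by auto
  have h: "heading \<Gamma> t = heading \<Gamma> t\<^sub>1 + v * (t - t\<^sub>1)" if "t \<in> {t\<^sub>1..t\<^sub>2}" for t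
    unfolding v_def by (rule segment_heading[OF ac seg(2)]) (use t that in auto)
  have "\<bar>v\<bar> * (t\<^sub>2 - t\<^sub>1) = pi"
  proof (rule half_turn_angle[OF \<open>v \<noteq> 0\<close> _ cos0(1)])
    show "cos (heading \<Gamma> t\<^sub>1 + v * (t\<^sub>2 - t\<^sub>1) - \<phi>) = 0"
      using cos0(2) h[of t\<^sub>2] t by simp
    fix s assume "s \<in> {0..t\<^sub>2 - t\<^sub>1}"
    then have s: "t\<^sub>1 + s \<in> {t\<^sub>1..t\<^sub>2}" by auto
    have "0 \<le> \<Lambda> * cos (heading \<Gamma> (t\<^sub>1 + s) - \<phi>)"
      using m2[OF s] by linarith
    then show "0 \<le> cos (heading \<Gamma> t\<^sub>1 + v * s - \<phi>)"
      using \<open>\<Lambda> > 0\<close> h[OF s] by (simp add: zero_le_mult_iff)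
  qed (use t in simp)
  then show ?thesis by (simp add: v_def)
qed

theorem theorem6:
  fixes U\<^sub>L U\<^sub>R \<mu>\<^sub>L \<mu>\<^sub>R :: real
    and c\<^sub>i c\<^sub>f :: config
    and \<Gamma> :: dubins_path
  assumes "U\<^sub>L > 0" and "U\<^sub>R > 0"
    and "\<mu>\<^sub>L \<ge> 0" and "\<mu>\<^sub>R \<ge> 0" and "\<mu>\<^sub>L + \<mu>\<^sub>R > 0"
    and "admissible_path U\<^sub>L U\<^sub>R c\<^sub>i c\<^sub>f \<Gamma>"
    and "nontrivial_CCC U\<^sub>L U\<^sub>R \<Gamma>"
  shows "\<not> (optimal_path U\<^sub>L U\<^sub>R \<mu>\<^sub>L \<mu>\<^sub>R c\<^sub>i c\<^sub>f \<Gamma> \<and>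
            (\<exists>e p q \<beta>. e = 0 \<and> pontryagin_multipliers U\<^sub>L U\<^sub>R \<mu>\<^sub>L \<mu>\<^sub>R \<Gamma> e p q \<beta>))"
proof
  assume *: "optimal_path U\<^sub>L U\<^sub>R \<mu>\<^sub>L \<mu>\<^sub>R c\<^sub>i c\<^sub>f \<Gamma> \<and>
            (\<exists>e p q \<beta>. e = 0 \<and> pontryagin_multipliers U\<^sub>L U\<^sub>R \<mu>\<^sub>L \<mu>\<^sub>R \<Gamma> e p q \<beta>)"
  then obtain p q \<beta> where pm: "pontryagin_multipliers U\<^sub>L U\<^sub>R \<mu>\<^sub>L \<mu>\<^sub>R \<Gamma> 0 p q \<beta>" by blast
  obtain X Y where "nontrivial_type U\<^sub>L U\<^sub>R \<Gamma> X Y X"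
    and opp: "turn_rate U\<^sub>L U\<^sub>R X * turn_rate U\<^sub>L U\<^sub>R Y < 0"
  proof -
    have "turn_rate U\<^sub>L U\<^sub>R Left_turn * turn_rate U\<^sub>L U\<^sub>R Right_turn < 0"
      "turn_rate U\<^sub>L U\<^sub>R Right_turn * turn_rate U\<^sub>L U\<^sub>R Left_turn < 0"
      using assms(1,2) by simp_all
    then show ?thesis using that assms(7) unfolding nontrivial_CCC_def by blast
  qed
  then obtain t\<^sub>1 t\<^sub>2 where t: "0 < t\<^sub>1" "t\<^sub>1 < t\<^sub>2" "t\<^sub>2 < final_time \<Gamma>"
    and seg: "is_segment U\<^sub>L U\<^sub>R \<Gamma> X 0 t\<^sub>1" "is_segment U\<^sub>L U\<^sub>R \<Gamma> Y t\<^sub>1 t\<^sub>2"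
      "is_segment U\<^sub>L U\<^sub>R \<Gamma> X t\<^sub>2 (final_time \<Gamma>)"
    unfolding nontrivial_type_def by blast
  have "\<bar>turn_rate U\<^sub>L U\<^sub>R Y\<bar> * (t\<^sub>2 - t\<^sub>1) = pi"
    by (rule abnormal_half_turn[OF assms(1,2,6) pm opp t seg])
  from half_turn_shortcut[OF assms(1-4,6) opp t seg this]
  show False
    using * unfolding optimal_path_def is_arg_min_def by blast
qed

end
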